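(* Let $n\ge1$. For any sequence $\alpha_1,\dots,\alpha_{n-1}$ of non-negative integers, there is a Gorenstein* poset $P$ of rank $n$ such that (i) $\alpha_S(P)=\prod_{i\in S}\alpha_i$ for all $S\in\mathcal A_n$; and (ii) there is an element $\sigma\in P$ of rank $n$ such that $\alpha_S(\partial\sigma)=\prod_{i\in S}\alpha_i$ for all $S\in\mathcal A_{n-1}$.
   Context: All posets are finite and have a minimal element $\hat 0$. $\partial\sigma=\{\tau\in P:\tau<\sigma\}$. The order complex $\Delta_P$ is the simplicial complex of all chains of $P\setminus\{\hat 0\}$ (including the empty chain); $\operatorname{rank}P$ is the maximal cardinality of an element of $\Delta_P$; for $\sigma\neq\hat 0$, $\operatorname{rank}\sigma$ is the maximal cardinality of a chain $C\in\Delta_P$ with $\max C=\sigma$. Fix an arbitrary field $K$. $P$ is Gorenstein* (over $K$) if for every face $F$ of $\Delta_P$ (including $\emptyset$), $\tilde H_i(\mathrm{lk}_{\Delta_P} F;K)$ is $K$ for $i=\dim\Delta_P-|F|$ and $0$ otherwise. If $P$ is Gorenstein* and $\sigma\in P\setminus\{\hat 0\}$, then $\partial\sigma$ is Gorenstein*; the one-element poset $\{\hat 0\}$ is Gorenstein* of rank $0$. For $P$ of rank $n$ and $S\subset[n]$, $f_S(P)$ is the number of chains in $\Delta_P$ whose set of ranks of elements is exactly $S$, $h_S(P)=\sum_{T\subset S}(-1)^{|S|-|T|}f_T(P)$, $w_S=w_1\cdots w_n$ is the non-commutative monomial with $w_i=\mathbf b$ if $i\in S$ and $w_i=\mathbf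 a$ otherwise, and $\Psi_P(\mathbf a,\mathbf b)=\sum_{S\subset[n]}h_S(P)w_S$. It is known that if $P$ is Gorenstein* there is a unique non-commutative polynomial $\Phi_P(\mathbf c,\mathbf d)\in\mathbb Z\langle\mathbf c,\mathbf d\rangle$, the $\mathbf{cd}$-index of $P$, with $\Phi_P(\mathbf a+\mathbf b,\mathbf a\mathbf b+\mathbf b\mathbf a)=\Psi_P(\mathbf a,\mathbf b)$; it is homogeneous of degree $n$ for $\deg\mathbf c=1,\deg\mathbf d=2$. $\mathcal A_n$ is the set of subsets of $\{1,\dots,n-1\}$ containing no two consecutive integers ($\mathcal A_0=\mathcal A_1=\{\emptyset\}$). There is a bijection $\kappa_n$ from the set of $\mathbf{cd}$-monomials of degree $n$ to $\mathcal A_n$ given by $$\kappa_n(\mathbf c^{s_0}\mathbf d\mathbf c^{s_1}\mathbf d\cdots\mathbf d\mathbf c^{s_k})=\{s_0+1,\;s_0+s_1+3,\;\dots,\;s_0+\cdots+s_{k-1}+2k-1\}.$$ For a Gorenstein* poset $P$ of rank $n$ and $S\in\mathcal A_n$, $\alpha_S(P)$ denotes the coefficient of the monomial $\kappa_n^{-1}(S)$ in $\Phi_P(\mathbf c,\mathbf d)$. *)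

theory Defs
  imports Main "HOL-Library.Poly_Mapping"
begin

section \<open>Finite posets with a minimal element\<close>

text \<open>
  A poset is given by its reflexive order relation \<open>r\<close>; its underlying set is \<open>Field r\<close>.
\<close>

definition is_bottom :: "'a rel \<Rightarrow> 'a \<Rightarrow> bool" where
  "is_bottom r z \<longleftrightarrow> z \<in> Field r \<and> (\<forall>x \<in> Field r. (z, x) \<in> r)"

definition bottom :: "'a rel \<Rightarrow> 'a" where
  "bottom r = (THE z. is_bottom r z)"

definition finite_poset_bot :: "'a rel \<Rightarrow> bool" where
  "finite_poset_bot r \<longleftrightarrow> finite (Field r) \<and> Partial_order r \<and> (\<exists>z. is_bottom r z)"

definition boundary_poset :: "'a rel \<Rightarrow> 'a \<Rightarrow> 'a rel" where
  "boundary_poset r \<sigma> = Restr r (underS r \<sigma>)"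

definition order_complex :: "'a rel \<Rightarrow> 'a set set" where
  "order_complex r = {C. C \<in> Chains r \<and> bottom r \<notin> C}"

definition poset_rank :: "'a rel \<Rightarrow> nat" where
  "poset_rank r = Max (card ` order_complex r)"

text \<open>Only meaningful for \<open>\<sigma>\<close> different from the minimal element.\<close>

definition elem_rank :: "'a rel \<Rightarrow> 'a \<Rightarrow> nat" where
  "elem_rank r \<sigma> = Max (card ` {C \<in> order_complex r. \<sigma> \<in> C \<and> (\<forall>x \<in> C. (x, \<sigma>) \<in> r)})"

section \<open>Reduced simplicial homology with coefficients in a field\<close>

text \<open>
  A finite simplicial complex \<open>\<Delta>\<close> is the set of its faces, including the empty face of
  dimension \<open>-1\<close>. Faces are oriented by a relation \<open>r\<close> that orders every face linearly; for
  the order complex of a poset (and the links in it) this is the order of the poset.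
  A chain is its coefficient function, extended by 0 to all sets.
\<close>

definition complex_dim :: "'a set set \<Rightarrow> int" where
  "complex_dim \<Delta> = Max ((\<lambda>F. int (card F) - 1) ` \<Delta>)"

definition link :: "'a set set \<Rightarrow> 'a set \<Rightarrow> 'a set set" where
  "link \<Delta> F = {G \<in> \<Delta>. F \<inter> G = {} \<and> F \<union> G \<in> \<Delta>}"

definition simplicial_chains :: "'a set set \<Rightarrow> int \<Rightarrow> ('a set \<Rightarrow> 'k::field) set" where
  "simplicial_chains \<Delta> i = {c. \<forall>F. c F \<noteq> 0 \<longrightarrow> F \<in> \<Delta> \<and> int (card F) - 1 = i}"

text \<open>
  The linear extension of
  \<open>{v\<^sub>0 < \<dots> < v\<^sub>i} \<mapsto> \<Sum>j\<le>i. (-1)^j {v\<^sub>0, \<dots>, v\<^sub>i} - {v\<^sub>j}\<close>,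
  read off at the coefficient of the face \<open>G\<close>. For \<open>i = 0\<close> this is the augmentation.
\<close>

definition simplicial_boundary ::
  "'a rel \<Rightarrow> 'a set set \<Rightarrow> ('a set \<Rightarrow> 'k::field) \<Rightarrow> 'a set \<Rightarrow> 'k" where
  "simplicial_boundary r \<Delta> c G =
     (\<Sum>v | v \<notin> G \<and> insert v G \<in> \<Delta>. (-1) ^ card {u \<in> G. (u, v) \<in> r} * c (insert v G))"

definition simplicial_cycles :: "'a rel \<Rightarrow> 'a set set \<Rightarrow> int \<Rightarrow> ('a set \<Rightarrow> 'k::field) set" where
  "simplicial_cycles r \<Delta> i =
     {c \<in> simplicial_chains \<Delta> i. simplicial_boundary r \<Delta> c = (\<lambda>_. 0)}"

definition simplicial_boundaries :: "'a rel \<Rightarrow> 'a set set \<Rightarrow> int \<Rightarrow> ('a set \<Rightarrow> 'k::field) set" where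
  "simplicial_boundaries r \<Delta> i = simplicial_boundary r \<Delta> ` simplicial_chains \<Delta> (i + 1)"

definition homologous_rel ::
  "'a rel \<Rightarrow> 'a set set \<Rightarrow> int \<Rightarrow> ('a set \<Rightarrow> 'k::field) rel" where
  "homologous_rel r \<Delta> i =
     {(x, y). x \<in> simplicial_cycles r \<Delta> i \<and> y \<in> simplicial_cycles r \<Delta> i \<and>
              (\<lambda>F. x F - y F) \<in> simplicial_boundaries r \<Delta> i}"

definition reduced_homology ::
  "'a rel \<Rightarrow> 'a set set \<Rightarrow> int \<Rightarrow> ('a set \<Rightarrow> 'k::field) set set" where
  "reduced_homology r \<Delta> i = simplicial_cycles r \<Delta> i // homologous_rel r \<Delta> i"

definition homology_zero :: "'k::field itself \<Rightarrow> 'a rel \<Rightarrow> 'a set set \<Rightarrow> int \<Rightarrow> bool" where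
  "homology_zero (_ :: 'k itself) r \<Delta> i \<longleftrightarrow>
     is_singleton (reduced_homology r \<Delta> i :: ('a set \<Rightarrow> 'k) set set)"

text \<open>
  The homology is isomorphic to the field as a vector space: there is a bijection \<open>\<phi>\<close>, linear
  for the operations that the quotient inherits from the cycles.
\<close>

definition homology_field :: "'k::field itself \<Rightarrow> 'a rel \<Rightarrow> 'a set set \<Rightarrow> int \<Rightarrow> bool" where
  "homology_field (_ :: 'k itself) r \<Delta> i \<longleftrightarrow>
     (\<exists>\<phi> :: ('a set \<Rightarrow> 'k) set \<Rightarrow> 'k.
        bij_betw \<phi> (reduced_homology r \<Delta> i) UNIV \<and>
        (\<forall>x \<in> simplicial_cycles r \<Delta> i. \<forall>y \<in> simplicial_cycles r \<Delta> i.
           \<phi> (homologous_rel r \<Delta> i `` {\<lambda>F. x F + y F}) =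
           \<phi> (homologous_rel r \<Delta> i `` {x}) + \<phi> (homologous_rel r \<Delta> i `` {y})) \<and>
        (\<forall>a. \<forall>x \<in> simplicial_cycles r \<Delta> i.
           \<phi> (homologous_rel r \<Delta> i `` {\<lambda>F. a * x F}) =
           a * \<phi> (homologous_rel r \<Delta> i `` {x})))"

definition gorenstein_star :: "'k::field itself \<Rightarrow> 'a rel \<Rightarrow> bool" where
  "gorenstein_star K r \<longleftrightarrow>
     finite_poset_bot r \<and>
     (\<forall>F \<in> order_complex r. \<forall>i :: int.
        if i = complex_dim (order_complex r) - int (card F)
        then homology_field K r (link (order_complex r) F) i
        else homology_zero K r (link (order_complex r) F) i)"

section \<open>Non-commutative polynomials\<close>

text \<open>
  The free monoid, written additively because the product of polynomial mappings convolves
  over an additive monoid of exponents: \<open>'x free_monoid \<Rightarrow>\<^sub>0 int\<close> is then the free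
  associative ring with unit on the letters in \<open>'x\<close>.
\<close>

datatype 'x free_monoid = Word (letters: "'x list")

instantiation free_monoid :: (type) monoid_add
begin

definition "0 = Word []"

definition "u + v = Word (letters u @ letters v)"

instance
  by standard (simp_all add: zero_free_monoid_def plus_free_monoid_def)

end

type_synonym 'x ncpoly = "'x free_monoid \<Rightarrow>\<^sub>0 int"

definition nc_var :: "'x \<Rightarrow> 'x ncpoly" where
  "nc_var x = Poly_Mapping.single (Word [x]) 1"

definition nc_subst :: "('x \<Rightarrow> 'y ncpoly) \<Rightarrow> 'x ncpoly \<Rightarrow> 'y ncpoly" where
  "nc_subst g p =
     (\<Sum>w \<in> Poly_Mapping.keys p.
        of_int (Poly_Mapping.lookup p w) * prod_list (map g (letters w)))"

section \<open>The ab-index and the cd-index\<close>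

datatype ab = LA | LB

datatype cd = LC | LD

definition flag_f :: "'a rel \<Rightarrow> nat set \<Rightarrow> nat" where
  "flag_f r S = card {C \<in> order_complex r. elem_rank r ` C = S}"

definition flag_h :: "'a rel \<Rightarrow> nat set \<Rightarrow> int" where
  "flag_h r S = (\<Sum>T \<in> Pow S. (-1) ^ (card S - card T) * int (flag_f r T))"

definition ab_word :: "nat \<Rightarrow> nat set \<Rightarrow> ab free_monoid" where
  "ab_word n S = Word (map (\<lambda>i. if i \<in> S then LB else LA) [1..<Suc n])"

definition ab_index :: "'a rel \<Rightarrow> ab ncpoly" where
  "ab_index r =
     (\<Sum>S \<in> Pow {1..poset_rank r}. Poly_Mapping.single (ab_word (poset_rank r) S) (flag_h r S))"

fun cd_to_ab :: "cd \<Rightarrow> ab ncpoly" where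
  "cd_to_ab LC = nc_var LA + nc_var LB"
| "cd_to_ab LD = nc_var LA * nc_var LB + nc_var LB * nc_var LA"

definition cd_index :: "'a rel \<Rightarrow> cd ncpoly" where
  "cd_index r = (THE \<Phi>. nc_subst cd_to_ab \<Phi> = ab_index r)"

section \<open>Indexing of cd-monomials by sparse sets\<close>

definition sparse_sets :: "nat \<Rightarrow> nat set set" where
  "sparse_sets n = {S. S \<subseteq> {1..<n} \<and> (\<forall>i. \<not> (i \<in> S \<and> Suc i \<in> S))}"

fun cd_letter_degree :: "cd \<Rightarrow> nat" where
  "cd_letter_degree LC = 1"
| "cd_letter_degree LD = 2"

definition cd_degree :: "cd list \<Rightarrow> nat" where
  "cd_degree w = sum_list (map cd_letter_degree w)"

definition cd_monomials :: "nat \<Rightarrow> cd free_monoid set" where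
  "cd_monomials n = {w. cd_degree (letters w) = n}"

text \<open>
  Each letter d contributes one plus the degree of the part of the monomial before it; the
  lemma \<open>kappa_exponents\<close> below is the usual description by exponents.
\<close>

definition kappa :: "cd free_monoid \<Rightarrow> nat set" where
  "kappa w = {Suc (cd_degree (take k (letters w))) | k.
                k < length (letters w) \<and> letters w ! k = LD}"

definition cd_coeff :: "'a rel \<Rightarrow> nat set \<Rightarrow> int" where
  "cd_coeff r S =
     Poly_Mapping.lookup (cd_index r) (inv_into (cd_monomials (poset_rank r)) kappa S)"

lemma kappa_append:
  "kappa (Word (u @ v)) = kappa (Word u) \<union> (\<lambda>m. cd_degree u + m) ` kappa (Word v)"
proof (intro set_eqI iffI)
  fix m
  assume "m \<in> kappa (Word (u @ v))"
  then obtain k where k: "k < length (u @ v)" "(u @ v) ! k = LD"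
      "m = Suc (cd_degree (take k (u @ v)))"
    unfolding kappa_def by auto
  show "m \<in> kappa (Word u) \<union> (\<lambda>m. cd_degree u + m) ` kappa (Word v)"
  proof (cases "k < length u")
    case True
    then show ?thesis using k unfolding kappa_def by (auto simp: nth_append)
  next
    case False
    then have "Suc (cd_degree (take (k - length u) v)) \<in> kappa (Word v)"
      using k unfolding kappa_def by (auto simp: nth_append)
    moreover have "m = cd_degree u + Suc (cd_degree (take (k - length u) v))"
      using False k(3) by (simp add: cd_degree_def)
    ultimately show ?thesis by blast
  qed
next
  fix m
  assume "m \<in> kappa (Word u) \<union> (\<lambda>m. cd_degree u + m) ` kappa (Word v)"
  then consider "m \<in> kappa (Word u)" | m' where "m' \<in> kappa (Word v)" "m = cd_degree u + m'"
    by blast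
  then show "m \<in> kappa (Word (u @ v))"
  proof cases
    case 1
    then obtain k where "k < length u" "u ! k = LD" "m = Suc (cd_degree (take k u))"
      unfolding kappa_def by auto
    then show ?thesis
      unfolding kappa_def by (auto simp: nth_append intro!: exI[of _ k])
  next
    case 2
    then obtain k where "k < length v" "v ! k = LD" "m' = Suc (cd_degree (take k v))"
      unfolding kappa_def by auto
    then show ?thesis using 2(2)
      unfolding kappa_def
      by (auto simp: nth_append cd_degree_def intro!: exI[of _ "length u + k"])
  qed
qed

lemma kappa_replicate_c: "kappa (Word (replicate s LC)) = {}"
  by (auto simp: kappa_def)

lemma kappa_d_c: "kappa (Word (LD # replicate s LC)) = {1}"
  using kappa_append[of "[LD]" "replicate s LC"]
  by (auto simp: kappa_def cd_degree_def)

lemma kappa_exponents: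
  "kappa (Word (replicate (s 0) LC @ concat (map (\<lambda>i. LD # replicate (s i) LC) [1..<Suc k]))) =
     {(\<Sum>i<j. s i) + 2 * j - 1 | j. 1 \<le> j \<and> j \<le> k}"
proof (induction k)
  case 0
  show ?case by (auto simp: kappa_replicate_c)
next
  case (Suc k)
  define w where
    "w k = replicate (s 0) LC @ concat (map (\<lambda>i. LD # replicate (s i) LC) [1..<Suc k])" for k
  have step: "w (Suc k) = w k @ LD # replicate (s (Suc k)) LC" for k
    by (simp add: w_def)
  have deg: "cd_degree (w k) = (\<Sum>i<Suc k. s i) + 2 * k" for k
    by (induction k) (simp_all add: step, simp_all add: w_def cd_degree_def sum_list_replicate)
  have "kappa (Word (w (Suc k))) = kappa (Word (w k)) \<union> {(\<Sum>i<Suc k. s i) + 2 * k + 1}"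
    by (simp only: step kappa_append kappa_d_c deg image_insert image_empty)
  also have "\<dots> = {(\<Sum>i<j. s i) + 2 * j - 1 | j. 1 \<le> j \<and> j \<le> Suc k}"
  proof -
    have "{f j | j. 1 \<le> j \<and> j \<le> Suc k} = {f j | j. 1 \<le> j \<and> j \<le> k} \<union> {f (Suc k)}"
      for f :: "nat \<Rightarrow> nat"
      by (auto simp: le_Suc_eq)
    then show ?thesis using Suc.IH[folded w_def] by simp
  qed
  finally show ?case by (simp only: w_def)
qed

end

theory Submission
  imports Defs
begin

text \<open>
  Proof idea. By induction on \<open>n\<close> one constructs a sphere \<open>P\<^sub>n\<close> of rank \<open>n\<close> with a facet \<open>\<sigma>\<close>
  such that the cd-indices \<open>\<Phi>\<^sub>n\<close> of \<open>P\<^sub>n\<close> and \<open>\<Phi>\<^bsub>n-1\<^esub>\<close> of the boundary of \<open>\<sigma>\<close> have the required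
  coefficients. Put \<open>k = \<alpha>\<^sub>n\<close> and replace \<open>\<sigma>\<close> by a stack of \<open>k\<close> lenses: take parallel copies
  \<open>s\<^sub>0 = \<sigma>, s\<^sub>1, \<dots>, s\<^sub>k\<close> of \<open>\<sigma>\<close> with the same boundary, a cell \<open>t\<^sub>j\<close> between \<open>s\<^bsub>j-1\<^esub>\<close> and \<open>s\<^sub>j\<close> for
  \<open>1 \<le> j \<le> k\<close>, and two more cells \<open>t\<^sub>0\<close> and \<open>t\<^bsub>k+1\<^esub>\<close> glued onto \<open>P\<^sub>n\<close> and onto \<open>P\<^sub>n\<close> with \<open>s\<^sub>k\<close> in
  place of \<open>\<sigma>\<close>. Counting flags gives \<open>\<Phi>\<^bsub>n+1\<^esub> = \<Phi>\<^sub>n c + k \<Phi>\<^bsub>n-1\<^esub> d\<close>, and \<open>t\<^sub>0\<close> has boundary \<open>P\<^sub>n\<close>.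

  The Gorenstein* property is derived from a combinatorial condition on comparability graphs:
  if deleting the vertex \<open>v\<close> from a complex leaves an acyclic complex, then the homology of the
  complex is that of the link of \<open>v\<close>, shifted by one.
\<close>

section \<open>Homology of the complex of chains of a finite partial order\<close>

text \<open>The recursion for the cd-polynomials is multiplicativity read from the last letter. A
  monomial of degree n+1 either ends in c, and then its set omits n, or ends in d, and then its set
  contains n while the rest is a set for degree n-1. The second case brings in the polynomial of
  degree n-1. Each lens adds flags of the boundary of the facet, so that polynomial has to be the
  cd-index of this boundary: (ii) must be carried through the induction, and \<open>t 0\<close>
  serves as the next facet because its boundary is the previous sphere. The number k of lenses is
  free, hence so is the next factor; for k = 0 two cells are glued along the old sphere, which
  multiplies by c.

  Gorenstein* speaks of the links of all faces, over an arbitrary field. A condition on adjacency of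
  vertices passes to links and does not see the field, so the effect of the stack has to be examined
  on links of vertices only.\<close>

definition comparable :: "'a rel \<Rightarrow> 'a \<Rightarrow> 'a \<Rightarrow> bool" where
  "comparable r u v \<longleftrightarrow> u \<noteq> v \<and> ((u, v) \<in> r \<or> (v, u) \<in> r)"

definition chains_in :: "'a rel \<Rightarrow> 'a set \<Rightarrow> 'a set set" where
  "chains_in r A = {C. C \<subseteq> A \<and> C \<in> Chains r}"

definition insertion_sign :: "'a rel \<Rightarrow> 'a \<Rightarrow> 'a set \<Rightarrow> 'k::field" where
  "insertion_sign r v G = (-1) ^ card {u \<in> G. (u, v) \<in> r}"

text \<open>The part of a chain on the faces through \<open>v\<close>, read as a chain on the link
  of \<open>v\<close>. With this sign it anticommutes with the boundary map.\<close>

definition vertex_residue :: "'a rel \<Rightarrow> 'a \<Rightarrow> ('a set \<Rightarrow> 'k::field) \<Rightarrow> 'a set \<Rightarrow> 'k" where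
  "vertex_residue r v c G = (if v \<in> G then 0 else insertion_sign r v G * c (insert v G))"

definition vertex_deletion :: "'a \<Rightarrow> ('a set \<Rightarrow> 'k::field) \<Rightarrow> 'a set \<Rightarrow> 'k" where
  "vertex_deletion v c G = (if v \<in> G then 0 else c G)"

text \<open>Assembles a chain from its deletion \<open>b\<close> and its residue \<open>e\<close>;
  the same sign serves in both directions because its square is 1.\<close>

definition vertex_join ::
  "'a rel \<Rightarrow> 'a \<Rightarrow> ('a set \<Rightarrow> 'k::field) \<Rightarrow> ('a set \<Rightarrow> 'k) \<Rightarrow> 'a set \<Rightarrow> 'k" where
  "vertex_join r v b e F =
     (if v \<in> F then insertion_sign r v (F - {v}) * e (F - {v}) else b F)"

text \<open>The boundary map of the full complex; subcomplexes inherit it.\<close>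

definition chain_boundary :: "'a rel \<Rightarrow> ('a set \<Rightarrow> 'k::field) \<Rightarrow> 'a set \<Rightarrow> 'k" where
  "chain_boundary r c G = (\<Sum>v \<in> Field r - G. insertion_sign r v G * c (insert v G))"

abbreviation order_chains :: "'a rel \<Rightarrow> 'a set \<Rightarrow> int \<Rightarrow> ('a set \<Rightarrow> 'k::field) set" where
  "order_chains r A i \<equiv> simplicial_chains (chains_in r A) i"

definition exact_at :: "'k::field itself \<Rightarrow> 'a rel \<Rightarrow> 'a set \<Rightarrow> int \<Rightarrow> bool" where
  "exact_at (_ :: 'k itself) r A i \<longleftrightarrow>
     (\<forall>c \<in> order_chains r A i. chain_boundary r c = (\<lambda>_. 0 :: 'k) \<longrightarrow>
        (\<exists>b \<in> order_chains r A (i + 1). chain_boundary r b = c))"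

text \<open>One-dimensional homology without forming the quotient. The functional is linear on all
  functions, not only on cycles, so it can be pulled back along any linear map.\<close>

definition line_at :: "'k::field itself \<Rightarrow> 'a rel \<Rightarrow> 'a set \<Rightarrow> int \<Rightarrow> bool" where
  "line_at (_ :: 'k itself) r A i \<longleftrightarrow>
     (\<exists>\<phi> :: ('a set \<Rightarrow> 'k) \<Rightarrow> 'k.
        (\<forall>x y. \<phi> (\<lambda>F. x F + y F) = \<phi> x + \<phi> y) \<and>
        (\<forall>a x. \<phi> (\<lambda>F. a * x F) = a * \<phi> x) \<and>
        (\<forall>a. \<exists>x \<in> order_chains r A i. chain_boundary r x = (\<lambda>_. 0) \<and> \<phi> x = a) \<and>
        (\<forall>x \<in> order_chains r A i. chain_boundary r x = (\<lambda>_. 0) \<longrightarrow>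
           (\<phi> x = 0 \<longleftrightarrow> (\<exists>b \<in> order_chains r A (i + 1). chain_boundary r b = x))))"

locale finite_order =
  fixes r :: "'a rel"
  assumes finite_Field: "finite (Field r)" and partial_order: "Partial_order r"
begin

lemma refl: "x \<in> Field r \<Longrightarrow> (x, x) \<in> r"
  using partial_order by (auto simp: partial_order_on_def preorder_on_def refl_on_def)

lemma antisym: "(x, y) \<in> r \<Longrightarrow> (y, x) \<in> r \<Longrightarrow> x = y"
  using partial_order by (auto simp: partial_order_on_def dest: antisymD)

lemma trans: "(x, y) \<in> r \<Longrightarrow> (y, z) \<in> r \<Longrightarrow> (x, z) \<in> r"
  using partial_order by (auto simp: partial_order_on_def preorder_on_def dest: transD)

text \<open>Chains are the cliques of the comparability graph; \<open>A \<subseteq> Field r\<close>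
  supplies the reflexive pairs that \<open>Chains\<close> asks for.\<close>

lemma chains_in_alt:
  assumes "A \<subseteq> Field r"
  shows "C \<in> chains_in r A \<longleftrightarrow> C \<subseteq> A \<and> (\<forall>x \<in> C. \<forall>y \<in> C. x \<noteq> y \<longrightarrow> comparable r x y)"
  using refl[OF subsetD[OF assms]] unfolding chains_in_def Chains_def comparable_def mem_Collect_eq
  by (metis subsetD)

lemma Field_of_chain: "C \<in> Chains r \<Longrightarrow> C \<subseteq> Field r"
  unfolding Chains_def Field_def by blast

lemma finite_chain: "C \<in> chains_in r A \<Longrightarrow> finite C"
  using finite_Field Field_of_chain unfolding chains_in_def by (blast intro: finite_subset)

lemma order_chains_zero: "c \<in> order_chains r A i \<Longrightarrow> F \<notin> chains_in r A \<Longrightarrow> c F = 0"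
  unfolding simplicial_chains_def by blast

lemma simplicial_boundary_eq:
  assumes "c \<in> order_chains r A i"
  shows "simplicial_boundary r (chains_in r A) c = chain_boundary r c"
proof
  fix G
  have "{v. v \<notin> G \<and> insert v G \<in> chains_in r A} \<subseteq> Field r - G"
    using Field_of_chain unfolding chains_in_def by blast
  moreover have "c (insert v G) = 0" if "insert v G \<notin> chains_in r A" for v
    using assms that by (rule order_chains_zero)
  ultimately show "simplicial_boundary r (chains_in r A) c G = chain_boundary r c G"
    unfolding simplicial_boundary_def chain_boundary_def insertion_sign_def
    by (intro sum.mono_neutral_left) (use finite_Field in auto)
qed

lemma insertion_sign_insert:
  assumes "finite G" "v \<notin> G"
  shows "insertion_sign r w (insert v G) =
           (if (v, w) \<in> r then - insertion_sign r w G else (insertion_sign r w G :: 'k::field))"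
proof -
  have "{u \<in> insert v G. (u, w) \<in> r} =
        (if (v, w) \<in> r then insert v {u \<in> G. (u, w) \<in> r} else {u \<in> G. (u, w) \<in> r})"
    by auto
  then show ?thesis using assms unfolding insertion_sign_def by simp
qed

text \<open>Exactly one of \<open>v\<close> and \<open>w\<close> lies below the other, so exactly
  one of the two insertions changes the sign of the other. This is the cancellation behind the
  vanishing of the square of the boundary map.\<close>

lemma insertion_sign_swap:
  assumes "finite G" "v \<notin> G" "w \<notin> G" "comparable r v w"
  shows "insertion_sign r v G * insertion_sign r w (insert v G) =
         - (insertion_sign r w G * insertion_sign r v (insert w G) :: 'k::field)"
proof -
  have "(v, w) \<in> r \<longleftrightarrow> (w, v) \<notin> r" using assms(4) antisym[of v w] unfolding comparable_def by blast
  then show ?thesis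
    using assms(1) insertion_sign_insert[OF assms(1,2), of w, where 'k = 'k]
      insertion_sign_insert[OF assms(1,3), of v, where 'k = 'k]
    by (cases "(v, w) \<in> r") (simp_all add: mult.commute)
qed

lemma insertion_sign_square: "insertion_sign r v G * (insertion_sign r v G * x) = (x :: 'k::field)"
proof -
  have "insertion_sign r v G * insertion_sign r v G = (1 :: 'k)"
    unfolding insertion_sign_def by (simp flip: power_mult_distrib)
  then show ?thesis by (simp flip: mult.assoc)
qed

lemma chain_boundary_add:
  "chain_boundary r (\<lambda>F. x F + y F) = (\<lambda>F. chain_boundary r x F + chain_boundary r y F)"
  unfolding chain_boundary_def by (auto simp: sum.distrib algebra_simps)

lemma chain_boundary_scale:
  "chain_boundary r (\<lambda>F. a * x F) = (\<lambda>F. a * chain_boundary r x F)"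
  unfolding chain_boundary_def by (auto simp: sum_distrib_left algebra_simps)

lemma chain_boundary_zero [simp]: "chain_boundary r (\<lambda>_. 0) = (\<lambda>_. 0)"
  unfolding chain_boundary_def by simp

lemma order_chains_add:
  "x \<in> order_chains r A i \<Longrightarrow> y \<in> order_chains r A i \<Longrightarrow> (\<lambda>F. x F + y F) \<in> order_chains r A i"
  unfolding simplicial_chains_def by (smt (verit) add.right_neutral mem_Collect_eq)

lemma order_chains_scale: "x \<in> order_chains r A i \<Longrightarrow> (\<lambda>F. a * x F) \<in> order_chains r A i"
  unfolding simplicial_chains_def by auto

lemma order_chains_null [simp]: "(\<lambda>_. 0) \<in> order_chains r A i"
  unfolding simplicial_chains_def by auto

lemma order_chains_mono: "c \<in> order_chains r A i \<Longrightarrow> A \<subseteq> A' \<Longrightarrow> c \<in> order_chains r A' i"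
  unfolding simplicial_chains_def chains_in_def by blast

end

section \<open>Deletion and link of a vertex\<close>

locale order_vertex = finite_order +
  fixes A :: "'a set" and v :: 'a
  assumes subset_Field: "A \<subseteq> Field r" and vertex_in: "v \<in> A"
begin

abbreviation "star_link \<equiv> A \<inter> {u. comparable r v u}"

lemma insert_vertex_chain_iff:
  assumes "v \<notin> G"
  shows "insert v G \<in> chains_in r A \<longleftrightarrow> G \<in> chains_in r star_link"
  using assms vertex_in subset_Field
  by (subst (1 2) chains_in_alt) (auto simp: comparable_def)

lemma star_link_subset: "star_link \<subseteq> A - {v}"
  by (auto simp: comparable_def)

lemma deletion_in_chains:
  "c \<in> order_chains r A i \<Longrightarrow> vertex_deletion v c \<in> order_chains r (A - {v}) i"
  unfolding simplicial_chains_def vertex_deletion_def chains_in_def by auto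

lemma residue_in_chains:
  assumes "c \<in> order_chains r A i"
  shows "vertex_residue r v c \<in> order_chains r star_link (i - 1)"
  unfolding simplicial_chains_def mem_Collect_eq
proof (intro allI impI)
  fix G assume "vertex_residue r v c G \<noteq> 0"
  then have G: "v \<notin> G" "c (insert v G) \<noteq> 0"
    by (auto simp: vertex_residue_def split: if_splits)
  with assms have "insert v G \<in> chains_in r A" "int (card (insert v G)) - 1 = i"
    unfolding simplicial_chains_def by blast+
  then show "G \<in> chains_in r star_link \<and> int (card G) - 1 = i - 1"
    using G insert_vertex_chain_iff finite_chain[of "insert v G" A] by auto
qed

lemma join_in_chains:
  assumes "b \<in> order_chains r (A - {v}) i" "e \<in> order_chains r star_link (i - 1)"
  shows "vertex_join r v b e \<in> order_chains r A i"
  unfolding simplicial_chains_def mem_Collect_eq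
proof (intro allI impI)
  fix F assume F: "vertex_join r v b e F \<noteq> 0"
  show "F \<in> chains_in r A \<and> int (card F) - 1 = i"
  proof (cases "v \<in> F")
    case True
    then have "e (F - {v}) \<noteq> 0" using F by (auto simp: vertex_join_def)
    then have e: "F - {v} \<in> chains_in r star_link" "int (card (F - {v})) - 1 = i - 1"
      using assms(2) unfolding simplicial_chains_def by blast+
    then have "finite F" using finite_chain by (metis finite_Diff_insert finite.emptyI Diff_empty)
    then show ?thesis
      using e True insert_vertex_chain_iff[of "F - {v}"] card_Suc_Diff1[of F v]
      by (auto simp: insert_absorb)
  next
    case False
    then have "b F \<noteq> 0" using F by (auto simp: vertex_join_def)
    then show ?thesis using assms(1) unfolding simplicial_chains_def chains_in_def by blast
  qed
qed

lemma deletion_join: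
  "b \<in> order_chains r (A - {v}) i \<Longrightarrow> vertex_deletion v (vertex_join r v b e) = b"
  unfolding vertex_deletion_def vertex_join_def simplicial_chains_def chains_in_def by fastforce

lemma residue_join:
  assumes "e \<in> order_chains r star_link i"
  shows "vertex_residue r v (vertex_join r v b e) = e"
proof
  fix G
  have "e G = 0" if "v \<in> G"
    using that order_chains_zero[OF assms] star_link_subset unfolding chains_in_def by blast
  then show "vertex_residue r v (vertex_join r v b e) G = e G"
    unfolding vertex_residue_def vertex_join_def by (simp add: insertion_sign_square)
qed

lemma chain_eqI:
  assumes "vertex_deletion v b = vertex_deletion v c" "vertex_residue r v b = vertex_residue r v c"
  shows "b = (c :: 'a set \<Rightarrow> 'k::field)"
proof
  fix F
  show "b F = c F"
  proof (cases "v \<in> F")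
    case True
    have "insertion_sign r v (F - {v}) * b F = insertion_sign r v (F - {v}) * c F"
      using fun_cong[OF assms(2), of "F - {v}"] True
      by (simp add: vertex_residue_def insert_absorb)
    then show ?thesis by (simp add: insertion_sign_def)
  next
    case False
    then show ?thesis using fun_cong[OF assms(1), of F] by (simp add: vertex_deletion_def)
  qed
qed

text \<open>
  The chain \<open>c\<close> is determined by its deletion and its residue, and in these coordinates the
  boundary map is that of a mapping cone.
\<close>

lemma deletion_boundary:
  "vertex_deletion v (chain_boundary r c) =
     (\<lambda>G. chain_boundary r (vertex_deletion v c) G + vertex_residue r v c G)"
proof
  fix G
  show "vertex_deletion v (chain_boundary r c) G =
          chain_boundary r (vertex_deletion v c) G + vertex_residue r v c G"
  proof (cases "v \<in> G")
    case True
    then show ?thesis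
      unfolding vertex_deletion_def vertex_residue_def chain_boundary_def by auto
  next
    case False
    have vF: "v \<in> Field r - G" using False vertex_in subset_Field by blast
    have "chain_boundary r c G = insertion_sign r v G * c (insert v G) +
            (\<Sum>u \<in> Field r - G - {v}. insertion_sign r u G * c (insert u G))"
      unfolding chain_boundary_def using vF finite_Field by (subst sum.remove[of _ v]) auto
    moreover have "chain_boundary r (vertex_deletion v c) G =
            (\<Sum>u \<in> Field r - G - {v}. insertion_sign r u G * c (insert u G))"
      unfolding chain_boundary_def using vF finite_Field False
      by (subst sum.remove[of _ v]) (auto simp: vertex_deletion_def intro!: sum.cong split: if_splits)
    ultimately show ?thesis using False
      by (simp add: vertex_deletion_def vertex_residue_def)
  qed
qed

text \<open>Removing \<open>u\<close> and \<open>v\<close> in the two orders differs by a sign if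
  they are comparable; otherwise no chain contains both and the coefficient is 0. Hence
  \<open>c\<close> has to be supported on chains here.\<close>

lemma residue_boundary:
  assumes c: "(c :: 'a set \<Rightarrow> 'k::field) \<in> order_chains r A i"
  shows "vertex_residue r v (chain_boundary r c) = (\<lambda>G. - chain_boundary r (vertex_residue r v c) G)"
proof
  fix G
  show "vertex_residue r v (chain_boundary r c) G = - chain_boundary r (vertex_residue r v c) G"
  proof (cases "v \<in> G")
    case True
    then show ?thesis unfolding vertex_residue_def chain_boundary_def by simp
  next
    case False
    have vF: "v \<in> Field r - G" using False vertex_in subset_Field by blast
    have swap: "insertion_sign r v G * (insertion_sign r u (insert v G) * c (insert u (insert v G))) =
          - (insertion_sign r u G * vertex_residue r v c (insert u G))"
      if u: "u \<in> Field r - insert v G" for u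
    proof (cases "insert u (insert v G) \<in> chains_in r A")
      case True
      then have "finite (insert u (insert v G))" by (rule finite_chain)
      moreover have "comparable r v u" using True u
        by (subst (asm) chains_in_alt[OF subset_Field]) auto
      ultimately show ?thesis
        using insertion_sign_swap[of G v u, where 'k = 'k] u False
        by (auto simp: vertex_residue_def insert_commute simp flip: mult.assoc)
    next
      case nochain: False
      then have "c (insert u (insert v G)) = 0" using order_chains_zero[OF c] by blast
      then show ?thesis using u False by (auto simp: vertex_residue_def insert_commute)
    qed
    have "vertex_residue r v (chain_boundary r c) G =
        (\<Sum>u \<in> Field r - insert v G.
            insertion_sign r v G * (insertion_sign r u (insert v G) * c (insert u (insert v G))))"
      using False by (simp add: vertex_residue_def chain_boundary_def sum_distrib_left)
    also have "\<dots> = - (\<Sum>u \<in> Field r - insert v G. insertion_sign r u G * vertex_residue r v c (insert u G))"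
      using swap by (simp add: sum_negf)
    also have "(\<Sum>u \<in> Field r - insert v G. insertion_sign r u G * vertex_residue r v c (insert u G)) =
        chain_boundary r (vertex_residue r v c) G"
      unfolding chain_boundary_def using vF finite_Field
      by (intro sum.mono_neutral_left) (auto simp: vertex_residue_def)
    finally show ?thesis .
  qed
qed

text \<open>A cycle bounds the join of the apex \<open>v\<close> with its own deletion. The deletion
  of that boundary is right by construction, the residue because \<open>c\<close> is a
  cycle.\<close>

lemma exact_cone:
  assumes cone: "\<And>u. u \<in> A \<Longrightarrow> u \<noteq> v \<Longrightarrow> comparable r v u"
  shows "exact_at TYPE('k::field) r A i"
  unfolding exact_at_def
proof (intro ballI impI)
  fix c :: "'a set \<Rightarrow> 'k"
  assume c: "c \<in> order_chains r A i" and cyc: "chain_boundary r c = (\<lambda>_. 0)"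
  have lk: "star_link = A - {v}" using cone by (auto simp: comparable_def)
  define b where "b = vertex_join r v (\<lambda>_. 0) (vertex_deletion v c)"
  have b: "b \<in> order_chains r A (i + 1)"
    unfolding b_def using deletion_in_chains[OF c] by (intro join_in_chains) (simp_all add: lk)
  have del: "vertex_deletion v b = (\<lambda>_. 0)"
    unfolding b_def by (rule deletion_join[of _ i]) simp
  have res: "vertex_residue r v b = vertex_deletion v c"
    unfolding b_def using deletion_in_chains[OF c] by (intro residue_join) (simp add: lk)
  have "chain_boundary r b = c"
  proof (rule chain_eqI)
    show "vertex_deletion v (chain_boundary r b) = vertex_deletion v c"
      by (simp add: deletion_boundary del res)
    have "(\<lambda>G. chain_boundary r (vertex_deletion v c) G + vertex_residue r v c G) = (\<lambda>_. 0)"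
      using deletion_boundary[of c] cyc by (simp add: vertex_deletion_def fun_eq_iff)
    then show "vertex_residue r v (chain_boundary r b) = vertex_residue r v c"
      unfolding residue_boundary[OF b] res by (simp add: fun_eq_iff neg_eq_iff_add_eq_0)
  qed
  then show "\<exists>b \<in> order_chains r A (i + 1). chain_boundary r b = c" using b by blast
qed

lemma residue_cycle:
  assumes "c \<in> order_chains r A i" "chain_boundary r c = (\<lambda>_. 0)"
  shows "chain_boundary r (vertex_residue r v c) = (\<lambda>_. 0)"
proof
  fix G
  show "chain_boundary r (vertex_residue r v c) G = 0"
    using fun_cong[OF residue_boundary[OF assms(1)], of G] unfolding assms(2)
    by (simp add: vertex_residue_def split: if_splits)
qed

lemma residue_linear:
  "vertex_residue r v (\<lambda>F. x F + y F) = (\<lambda>F. vertex_residue r v x F + vertex_residue r v y F)"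
  "vertex_residue r v (\<lambda>F. a * x F) = (\<lambda>F. a * vertex_residue r v x F)"
  by (auto simp: vertex_residue_def algebra_simps)

context
  fixes K :: "'k::field itself"
  assumes exact_deletion: "\<And>i. exact_at K r (A - {v}) i"
begin

text \<open>Surjectivity of the residue map on homology: \<open>e\<close> is also a cycle of the
  acyclic deletion, so \<open>-e\<close> bounds some \<open>b\<close> there, and \<open>b\<close>
  closes up the cone over \<open>e\<close> with apex \<open>v\<close>.\<close>

lemma lift_cycle:
  fixes e :: "'a set \<Rightarrow> 'k"
  assumes e: "e \<in> order_chains r star_link (i - 1)" and cyc: "chain_boundary r e = (\<lambda>_. 0)"
  shows "\<exists>c \<in> order_chains r A i. chain_boundary r c = (\<lambda>_. 0) \<and> vertex_residue r v c = e"
proof -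
  have "(\<lambda>F. (-1) * e F) \<in> order_chains r (A - {v}) (i - 1)"
    using order_chains_scale[OF order_chains_mono[OF e star_link_subset]] .
  moreover have "chain_boundary r (\<lambda>F. (-1) * e F) = (\<lambda>_. 0)"
    unfolding chain_boundary_scale cyc by simp
  ultimately obtain b where b: "b \<in> order_chains r (A - {v}) i" "chain_boundary r b = (\<lambda>F. (-1) * e F)"
    using exact_deletion[of "i - 1"] unfolding exact_at_def by force
  define c where "c = vertex_join r v b e"
  have c: "c \<in> order_chains r A i" unfolding c_def by (rule join_in_chains[OF b(1) e])
  have del: "vertex_deletion v c = b" unfolding c_def by (rule deletion_join[OF b(1)])
  have res: "vertex_residue r v c = e" unfolding c_def by (rule residue_join[OF e])
  have "chain_boundary r c = (\<lambda>_. 0)"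
  proof (rule chain_eqI)
    show "vertex_deletion v (chain_boundary r c) = vertex_deletion v (\<lambda>_. 0)"
      unfolding deletion_boundary del res b(2) by (simp add: vertex_deletion_def fun_eq_iff)
    show "vertex_residue r v (chain_boundary r c) = vertex_residue r v (\<lambda>_. 0)"
      unfolding residue_boundary[OF c] res cyc by (simp add: vertex_residue_def fun_eq_iff)
  qed
  then show ?thesis using c res by blast
qed

text \<open>Injectivity of the residue map on homology, the other half of the isomorphism between
  the homology of \<open>A\<close> and that of the link of \<open>v\<close> one degree
  lower.\<close>

lemma boundary_iff_residue_boundary:
  fixes c :: "'a set \<Rightarrow> 'k"
  assumes c: "c \<in> order_chains r A i" and cyc: "chain_boundary r c = (\<lambda>_. 0)"
  shows "(\<exists>b \<in> order_chains r A (i + 1). chain_boundary r b = c) \<longleftrightarrow>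
         (\<exists>h \<in> order_chains r star_link i. chain_boundary r h = vertex_residue r v c)"
proof
  assume "\<exists>b \<in> order_chains r A (i + 1). chain_boundary r b = c"
  then obtain b where b: "b \<in> order_chains r A (i + 1)" "chain_boundary r b = c" by blast
  have "(\<lambda>F. (-1) * vertex_residue r v b F) \<in> order_chains r star_link i"
    using order_chains_scale[OF residue_in_chains[OF b(1)], of "-1"] by simp
  moreover have "chain_boundary r (\<lambda>F. (-1) * vertex_residue r v b F) = vertex_residue r v c"
    unfolding chain_boundary_scale using residue_boundary[OF b(1)] b(2) by simp
  ultimately show "\<exists>h \<in> order_chains r star_link i. chain_boundary r h = vertex_residue r v c"
    by blast
next
  assume "\<exists>h \<in> order_chains r star_link i. chain_boundary r h = vertex_residue r v c"
  then obtain h where h: "h \<in> order_chains r star_link i" "chain_boundary r h = vertex_residue r v c"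
    by blast
  \<comment> \<open>Since \<open>c\<close> is a cycle, the boundary of its deletion is minus its
    residue, and the boundary of \<open>h\<close> cancels this.\<close>
  define x where "x = (\<lambda>F. vertex_deletion v c F + h F)"
  have "x \<in> order_chains r (A - {v}) i"
    unfolding x_def by (intro order_chains_add deletion_in_chains c order_chains_mono[OF h(1)] star_link_subset)
  moreover have "chain_boundary r x = (\<lambda>_. 0)"
    unfolding x_def chain_boundary_add h(2) deletion_boundary[symmetric] cyc
    by (simp add: fun_eq_iff vertex_deletion_def)
  ultimately obtain b where b: "b \<in> order_chains r (A - {v}) (i + 1)" "chain_boundary r b = x"
    using exact_deletion[of i] unfolding exact_at_def by blast
  have h': "(\<lambda>F. (-1) * h F) \<in> order_chains r star_link (i + 1 - 1)"
    using order_chains_scale[OF h(1), of "-1"] by simp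
  define g where "g = vertex_join r v b (\<lambda>F. (-1) * h F)"
  have g: "g \<in> order_chains r A (i + 1)" unfolding g_def by (rule join_in_chains[OF b(1) h'])
  have del: "vertex_deletion v g = b" unfolding g_def by (rule deletion_join[OF b(1)])
  have res: "vertex_residue r v g = (\<lambda>F. (-1) * h F)" unfolding g_def by (rule residue_join[OF h'])
  have "chain_boundary r g = c"
  proof (rule chain_eqI)
    show "vertex_deletion v (chain_boundary r g) = vertex_deletion v c"
      unfolding deletion_boundary del res b(2) x_def by simp
    show "vertex_residue r v (chain_boundary r g) = vertex_residue r v c"
      unfolding residue_boundary[OF g] res chain_boundary_scale h(2) by simp
  qed
  then show "\<exists>b \<in> order_chains r A (i + 1). chain_boundary r b = c" using g by blast
qed

lemma exact_at_from_link: "exact_at K r star_link (i - 1) \<Longrightarrow> exact_at K r A i"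
  unfolding exact_at_def
  using boundary_iff_residue_boundary residue_cycle residue_in_chains by fastforce

text \<open>The functional is pulled back along the residue map; \<open>lift_cycle\<close> keeps it
  onto and \<open>boundary_iff_residue_boundary\<close> identifies its kernel on cycles.\<close>

lemma line_at_from_link:
  assumes "line_at K r star_link (i - 1)"
  shows "line_at K r A i"
proof -
  obtain \<phi> :: "('a set \<Rightarrow> 'k) \<Rightarrow> 'k" where \<phi>:
      "\<And>x y. \<phi> (\<lambda>F. x F + y F) = \<phi> x + \<phi> y"
      "\<And>a x. \<phi> (\<lambda>F. a * x F) = a * \<phi> x"
      "\<And>a. \<exists>x \<in> order_chains r star_link (i - 1). chain_boundary r x = (\<lambda>_. 0) \<and> \<phi> x = a"
      "\<And>x. x \<in> order_chains r star_link (i - 1) \<Longrightarrow> chain_boundary r x = (\<lambda>_. 0) \<Longrightarrow>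
           \<phi> x = 0 \<longleftrightarrow> (\<exists>b \<in> order_chains r star_link (i - 1 + 1). chain_boundary r b = x)"
    using assms unfolding line_at_def by blast
  show ?thesis
    unfolding line_at_def
  proof (intro exI[of _ "\<lambda>c. \<phi> (vertex_residue r v c)"] conjI allI ballI impI)
    fix a
    show "\<exists>x \<in> order_chains r A i. chain_boundary r x = (\<lambda>_. 0) \<and> \<phi> (vertex_residue r v x) = a"
      using \<phi>(3)[of a] lift_cycle[of _ i] by metis
  next
    fix x :: "'a set \<Rightarrow> 'k"
    assume x: "x \<in> order_chains r A i" "chain_boundary r x = (\<lambda>_. 0)"
    show "\<phi> (vertex_residue r v x) = 0 \<longleftrightarrow> (\<exists>b \<in> order_chains r A (i + 1). chain_boundary r b = x)"
      using \<phi>(4)[OF residue_in_chains residue_cycle] x boundary_iff_residue_boundary[OF x] by simp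
  qed (simp_all add: residue_linear \<phi>)
qed

end

end

section \<open>Spheres built from vertex deletions and links\<close>

text \<open>
  A set of vertices of the graph \<open>E\<close> stands for its clique complex; for the comparability
  graph of a poset this is the complex of chains.
\<close>

abbreviation nbrs :: "('a \<Rightarrow> 'a \<Rightarrow> bool) \<Rightarrow> 'a \<Rightarrow> 'a set" where
  "nbrs E v \<equiv> {u. E v u}"

inductive nonevasive :: "('a \<Rightarrow> 'a \<Rightarrow> bool) \<Rightarrow> 'a set \<Rightarrow> bool" for E where
  cone: "v \<in> A \<Longrightarrow> (\<And>u. u \<in> A \<Longrightarrow> u \<noteq> v \<Longrightarrow> E v u) \<Longrightarrow> nonevasive E A"
| delete: "v \<in> A \<Longrightarrow> nonevasive E (A - {v}) \<Longrightarrow> nonevasive E (A \<inter> nbrs E v) \<Longrightarrow> nonevasive E A"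

text \<open>A certificate of spherical homology. The index counts the vertices of a top-dimensional
  face, so the dimension is one less and the empty vertex set is the sphere of dimension -1.\<close>

inductive sphere_set :: "('a \<Rightarrow> 'a \<Rightarrow> bool) \<Rightarrow> nat \<Rightarrow> 'a set \<Rightarrow> bool" for E where
  empty: "sphere_set E 0 {}"
| vertex: "v \<in> A \<Longrightarrow> nonevasive E (A - {v}) \<Longrightarrow> sphere_set E n (A \<inter> nbrs E v) \<Longrightarrow>
           sphere_set E (Suc n) A"

text \<open>Repeating the demand on all vertex links makes it reach the link of every face, as
  Gorenstein* requires.\<close>

primrec manifold_set :: "('a \<Rightarrow> 'a \<Rightarrow> bool) \<Rightarrow> nat \<Rightarrow> 'a set \<Rightarrow> bool" where
  "manifold_set E 0 A \<longleftrightarrow> A = {}"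
| "manifold_set E (Suc n) A \<longleftrightarrow>
     sphere_set E (Suc n) A \<and> (\<forall>v \<in> A. manifold_set E n (A \<inter> nbrs E v))"

lemma manifold_set_sphere: "manifold_set E n A \<Longrightarrow> sphere_set E n A"
  by (cases n) (auto intro: sphere_set.empty)

text \<open>The certificates transport along isomorphisms of induced subgraphs. This is wanted for
  the far side of the stack, where the last layer takes the place of the original facet.\<close>

lemma nonevasive_image:
  assumes "nonevasive E A" "inj_on f A" "\<And>x y. x \<in> A \<Longrightarrow> y \<in> A \<Longrightarrow> E' (f x) (f y) = E x y"
  shows "nonevasive E' (f ` A)"
  using assms
proof (induction rule: nonevasive.induct)
  case (cone v A)
  then show ?case by (intro nonevasive.cone[of "f v"]) auto
next
  case (delete v A)
  have "f ` (A - {v}) = f ` A - {f v}" using delete.prems(1) delete.hyps(1)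
    by (simp add: inj_on_image_set_diff)
  moreover have "f ` (A \<inter> nbrs E v) = f ` A \<inter> nbrs E' (f v)"
    using delete.prems(2) delete.hyps(1) by auto
  moreover have "nonevasive E' (f ` (A - {v}))" "nonevasive E' (f ` (A \<inter> nbrs E v))"
    using delete.prems by (auto intro!: delete.IH intro: inj_on_subset)
  ultimately show ?case using delete.hyps(1) nonevasive.delete[of "f v" "f ` A" E'] by simp
qed

lemma sphere_set_image:
  assumes "sphere_set E n A" "inj_on f A" "\<And>x y. x \<in> A \<Longrightarrow> y \<in> A \<Longrightarrow> E' (f x) (f y) = E x y"
  shows "sphere_set E' n (f ` A)"
  using assms
proof (induction rule: sphere_set.induct)
  case empty
  then show ?case by (simp add: sphere_set.empty)
next
  case (vertex v A n)
  have "f ` (A - {v}) = f ` A - {f v}" using vertex.prems(1) vertex.hyps(1)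
    by (simp add: inj_on_image_set_diff)
  moreover have "f ` (A \<inter> nbrs E v) = f ` A \<inter> nbrs E' (f v)"
    using vertex.prems(2) vertex.hyps(1) by auto
  moreover have "nonevasive E' (f ` (A - {v}))"
    using vertex.prems vertex.hyps(2) by (auto intro!: nonevasive_image intro: inj_on_subset)
  moreover have "sphere_set E' n (f ` (A \<inter> nbrs E v))"
    using vertex.prems by (auto intro!: vertex.IH intro: inj_on_subset)
  ultimately show ?case using vertex.hyps(1) sphere_set.vertex[of "f v" "f ` A" E' n] by simp
qed

lemma manifold_set_image:
  assumes "manifold_set E n A" "inj_on f A" "\<And>x y. x \<in> A \<Longrightarrow> y \<in> A \<Longrightarrow> E' (f x) (f y) = E x y"
  shows "manifold_set E' n (f ` A)"
  using assms
proof (induction n arbitrary: A)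
  case (Suc n)
  have "sphere_set E' (Suc n) (f ` A)"
    using Suc.prems by (intro sphere_set_image) auto
  moreover have "manifold_set E' n (f ` A \<inter> nbrs E' (f v))" if "v \<in> A" for v
  proof -
    have "f ` (A \<inter> nbrs E v) = f ` A \<inter> nbrs E' (f v)" using Suc.prems(3) that by auto
    moreover have "manifold_set E' n (f ` (A \<inter> nbrs E v))"
      using Suc.prems that by (intro Suc.IH) (auto intro: inj_on_subset)
    ultimately show ?thesis by simp
  qed
  ultimately show ?case by auto
qed simp

lemma manifold_set_cong:
  assumes "manifold_set E n A" "\<And>x y. x \<in> A \<Longrightarrow> y \<in> A \<Longrightarrow> E' x y = E x y"
  shows "manifold_set E' n A"
  using manifold_set_image[of E n A id E'] assms by simp

text \<open>Deleting one suspension point leaves a cone over \<open>A\<close> whose apex is the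
  other one, and the link of the deleted point is \<open>A\<close>. The link of a vertex of
  \<open>A\<close> is again a suspension, which drives the induction.\<close>

lemma manifold_set_suspension:
  assumes "manifold_set E n A" "u \<notin> A" "w \<notin> A" "u \<noteq> w" "\<not> E u u" "\<not> E w w" "\<not> E u w" "\<not> E w u"
    and "\<And>x. x \<in> A \<Longrightarrow> E u x" "\<And>x. x \<in> A \<Longrightarrow> E w x"
    and "\<And>x. x \<in> A \<Longrightarrow> E x u" "\<And>x. x \<in> A \<Longrightarrow> E x w"
  shows "manifold_set E (Suc n) (A \<union> {u, w})"
  using assms
proof (induction n arbitrary: A)
  case 0
  have "sphere_set E (Suc 0) ({u, w})"
    using 0 by (intro sphere_set.vertex[of u] nonevasive.cone[of w]) (auto intro: sphere_set.empty)
  then show ?case using 0 by auto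
next
  case (Suc n)
  have lk: "(A \<union> {u, w}) \<inter> nbrs E u = A" "(A \<union> {u, w}) \<inter> nbrs E w = A"
    using Suc.prems by auto
  have "sphere_set E (Suc (Suc n)) (A \<union> {u, w})"
  proof (rule sphere_set.vertex[of u])
    show "nonevasive E (A \<union> {u, w} - {u})"
      using Suc.prems by (intro nonevasive.cone[of w]) auto
    show "sphere_set E (Suc n) ((A \<union> {u, w}) \<inter> nbrs E u)"
      using manifold_set_sphere[OF Suc.prems(1)] lk by simp
  qed simp
  moreover have "manifold_set E (Suc n) ((A \<union> {u, w}) \<inter> nbrs E v)" if "v \<in> A" for v
  proof -
    have "(A \<union> {u, w}) \<inter> nbrs E v = (A \<inter> nbrs E v) \<union> {u, w}" using Suc.prems that by auto
    moreover have "manifold_set E (Suc n) ((A \<inter> nbrs E v) \<union> {u, w})"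
      using Suc.prems that by (intro Suc.IH) auto
    ultimately show ?thesis by simp
  qed
  ultimately show ?case using Suc.prems(1) lk unfolding manifold_set.simps(2)[of E "Suc n"] by auto
qed

text \<open>
  The cell \<open>s 0\<close> of a sphere is thickened to a stack of \<open>k\<close> cells \<open>t 1, \<dots>, t k\<close> with the layers
  \<open>s 0, \<dots>, s k\<close> between them, and the two sides of the result are filled by the cells \<open>t 0\<close>
  and \<open>t (k + 1)\<close>.
\<close>

locale thickening =
  fixes E :: "'a \<Rightarrow> 'a \<Rightarrow> bool" and W :: "'a set" and s t :: "nat \<Rightarrow> 'a" and k :: nat
  assumes sym: "E x y \<Longrightarrow> E y x"
    and irrefl: "\<not> E x x"
    and s0: "s 0 \<in> W"
    and s_fresh: "j \<in> {1..k} \<Longrightarrow> s j \<notin> W"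
    and t_fresh: "j \<le> Suc k \<Longrightarrow> t j \<notin> W"
    and s_inj: "inj_on s {..k}" and t_inj: "inj_on t {..Suc k}"
    and s_neq_t: "i \<le> k \<Longrightarrow> j \<le> Suc k \<Longrightarrow> s i \<noteq> t j"
    and s_s: "i \<le> k \<Longrightarrow> j \<le> k \<Longrightarrow> \<not> E (s i) (s j)"
    and t_t: "i \<le> Suc k \<Longrightarrow> j \<le> Suc k \<Longrightarrow> \<not> E (t i) (t j)"
    and s_t: "i \<le> k \<Longrightarrow> j \<le> Suc k \<Longrightarrow> E (s i) (t j) \<longleftrightarrow> j = i \<or> j = Suc i"
    and s_W: "x \<in> W \<Longrightarrow> j \<le> k \<Longrightarrow> E x (s j) \<longleftrightarrow> E x (s 0)"
    and t_W: "x \<in> W \<Longrightarrow> x \<noteq> s 0 \<Longrightarrow> j \<le> Suc k \<Longrightarrow>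
                E x (t j) \<longleftrightarrow> j = 0 \<or> j = Suc k \<or> E x (s 0)"
begin

definition thick :: "'a set \<Rightarrow> 'a set" where
  "thick A = A \<union> s ` {..k} \<union> t ` {..Suc k}"

lemma sym_iff: "E x y \<longleftrightarrow> E y x"
  using sym by blast

lemma s_eq_iff: "i \<le> k \<Longrightarrow> j \<le> k \<Longrightarrow> s i = s j \<longleftrightarrow> i = j"
  using s_inj by (auto simp: inj_on_def)

lemma t_eq_iff: "i \<le> Suc k \<Longrightarrow> j \<le> Suc k \<Longrightarrow> t i = t j \<longleftrightarrow> i = j"
  using t_inj by (auto simp: inj_on_def)

lemma s_in_W_iff: "j \<le> k \<Longrightarrow> s j \<in> W \<longleftrightarrow> j = 0"
  using s0 s_fresh[of j] by (cases j) auto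

text \<open>What is left of \<open>thick A\<close> after the removal of
  \<open>s 0, ..., s (j - 1)\<close> and \<open>t 0, ..., t j\<close>.\<close>

definition upper_layers :: "'a set \<Rightarrow> nat \<Rightarrow> 'a set" where
  "upper_layers A j = (A - {s 0}) \<union> s ` {j..k} \<union> t ` {Suc j..Suc k}"

text \<open>The stack is peeled off alternately: \<open>s j\<close> goes first, its link being a
  cone with apex \<open>t (j + 1)\<close>, and then \<open>t (j + 1)\<close>, its link being a cone
  with apex \<open>s (j + 1)\<close>. At \<open>j = k\<close> all remaining vertices are adjacent to
  \<open>t (k + 1)\<close>.\<close>

lemma nonevasive_upper_layers:
  assumes A: "A \<subseteq> W" and "j \<le> k"
  shows "nonevasive E (upper_layers A j)"
  using assms(2)
proof (induction "k - j" arbitrary: j)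
  case 0
  then have [simp]: "j = k" by simp
  have "E (t (Suc k)) u" if "u \<in> upper_layers A j" "u \<noteq> t (Suc k)" for u
    using that A t_W[of u "Suc k"] s_t[of k "Suc k"] sym_iff
    by (auto simp: upper_layers_def)
  then show ?case by (intro nonevasive.cone[of "t (Suc k)"]) (auto simp: upper_layers_def)
next
  case (Suc d)
  then have j: "j < k" by simp
  let ?U = "upper_layers A j"
  let ?B = "A \<inter> nbrs E (s 0)"
  have A_link: "A \<inter> nbrs E (s j) = ?B" using A j s_W[of _ j] sym_iff by auto
  have ss: "s ` {j..k} \<inter> nbrs E (s j) = {}" using s_s[of j] j by auto
  have st: "t ` {Suc j..Suc k} \<inter> nbrs E (s j) = {t (Suc j)}" using s_t[of j] j by auto
  have lk_s: "?U \<inter> nbrs E (s j) = ?B \<union> {t (Suc j)}"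
    using A_link ss st irrefl[of "s 0"] by (auto simp: upper_layers_def)
  have cone_s: "nonevasive E (?B \<union> {t (Suc j)})"
    using A j t_W[of _ "Suc j"] irrefl[of "s 0"] sym_iff
    by (intro nonevasive.cone[of "t (Suc j)"]) auto
  \<comment> \<open>With \<open>s j\<close> gone, the only layer still adjacent to
    \<open>t (j + 1)\<close> is \<open>s (j + 1)\<close>, so the link becomes a cone.\<close>
  let ?V = "?U - {s j}"
  have A_link': "(A - {s 0}) \<inter> nbrs E (t (Suc j)) = ?B"
    using A j t_W[of _ "Suc j"] irrefl[of "s 0"] sym_iff by auto
  have ts: "s ` {Suc j..k} \<inter> nbrs E (t (Suc j)) = {s (Suc j)}"
    using s_t[of _ "Suc j"] j sym_iff by auto
  have tt: "t ` {Suc j..Suc k} \<inter> nbrs E (t (Suc j)) = {}" using t_t[of "Suc j"] j by auto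
  have V: "?V = (A - {s 0}) \<union> s ` {Suc j..k} \<union> t ` {Suc j..Suc k}"
  proof -
    have "s ` {j..k} = insert (s j) (s ` {Suc j..k})"
      using j by (metis atLeastAtMost_insertL image_insert less_imp_le)
    moreover have "s j \<notin> s ` {Suc j..k}" using s_eq_iff j by auto
    moreover have "s j \<notin> t ` {Suc j..Suc k}" using s_neq_t[of j] j by force
    moreover have "s j \<notin> A - {s 0}" using A s_in_W_iff[of j] j by auto
    ultimately show ?thesis unfolding upper_layers_def by blast
  qed
  have lk_t: "?V \<inter> nbrs E (t (Suc j)) = ?B \<union> {s (Suc j)}"
    unfolding V using A_link' ts tt by blast
  have cone_t: "nonevasive E (?B \<union> {s (Suc j)})"
    using A j s_W[of _ "Suc j"] sym_iff
    by (intro nonevasive.cone[of "s (Suc j)"]) auto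
  have rest: "?V - {t (Suc j)} = upper_layers A (Suc j)"
  proof -
    have "t ` {Suc j..Suc k} = insert (t (Suc j)) (t ` {Suc (Suc j)..Suc k})"
      using j by (metis atLeastAtMost_insertL image_insert less_imp_le Suc_le_mono)
    moreover have "t (Suc j) \<notin> t ` {Suc (Suc j)..Suc k}" using t_eq_iff j by auto
    moreover have "t (Suc j) \<notin> s ` {Suc j..k}" using s_neq_t[of _ "Suc j"] j by force
    moreover have "t (Suc j) \<notin> A" using A t_fresh[of "Suc j"] j by auto
    moreover have "X \<union> Y \<union> insert x Z - {x} = X \<union> Y \<union> Z"
      if "x \<notin> Z" "x \<notin> Y" "x \<notin> X" for x :: 'a and X Y Z using that by blast
    ultimately show ?thesis unfolding V unfolding upper_layers_def by simp
  qed
  have "nonevasive E (upper_layers A (Suc j))" using Suc j by (intro Suc.hyps) auto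
  then have "nonevasive E (?V - {t (Suc j)})" by (simp only: rest)
  moreover have "nonevasive E (?V \<inter> nbrs E (t (Suc j)))" using cone_t by (simp only: lk_t)
  moreover have "t (Suc j) \<in> ?V" unfolding V using j by simp
  ultimately have "nonevasive E ?V" by (metis nonevasive.delete)
  moreover have "nonevasive E (?U \<inter> nbrs E (s j))" using cone_s by (simp only: lk_s)
  moreover have "s j \<in> ?U" using j by (simp add: upper_layers_def)
  ultimately show ?case by (metis nonevasive.delete)
qed

text \<open>Away from \<open>s 0\<close> the stack is invisible: a vertex that is not adjacent to
  \<open>s 0\<close> meets only the two outer cells, and these suspend its old link.\<close>

lemma suspension_tops:
  assumes "manifold_set E n A" "A \<subseteq> W" "\<And>x. x \<in> A \<Longrightarrow> x \<noteq> s 0" 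
  shows "manifold_set E (Suc n) (A \<union> {t 0, t (Suc k)})"
proof (rule manifold_set_suspension)
  show top: "E x (t 0)" "E x (t (Suc k))" if "x \<in> A" for x
    using that assms(2,3) t_W[of x 0] t_W[of x "Suc k"] by auto
  show "E (t 0) x" "E (t (Suc k)) x" if "x \<in> A" for x
    using top[OF that] sym by blast+
qed (use assms t_fresh[of 0] t_fresh[of "Suc k"] t_eq_iff[of 0 "Suc k"] t_t[of 0] t_t[of "Suc k"] in auto)

text \<open>Stated for subsets \<open>A\<close> of \<open>W\<close> because the link of a vertex
  adjacent to \<open>s 0\<close> is itself the thickening of its old link. All other links are
  explicit: suspensions for layers, inner cells and vertices off the star of \<open>s 0\<close>, and
  copies of \<open>A\<close> for the two outer cells.\<close>

lemma manifold_thick: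
  assumes "A \<subseteq> W" "s 0 \<in> A" "manifold_set E n A"
  shows "manifold_set E (Suc n) (thick A)"
  using assms
proof (induction n arbitrary: A)
  case 0
  then show ?case by simp
next
  case (Suc n)
  note A = Suc.prems(1) and s0A = Suc.prems(2)
  let ?B = "A \<inter> nbrs E (s 0)"
  have B: "manifold_set E n ?B" using Suc.prems by simp
  have B_s: "x \<noteq> s 0" if "x \<in> ?B" for x using that irrefl by auto
  have tt: "t ` {..Suc k} \<inter> nbrs E (t j) = {}" if "j \<le> Suc k" for j
    using t_t that by auto
  have ss: "s ` {..k} \<inter> nbrs E (s j) = {}" if "j \<le> k" for j
    using s_s that by auto
  have t_links: "manifold_set E (Suc n) (thick A \<inter> nbrs E (t j))" if j: "j \<le> Suc k" for j
  proof -
    consider "j = 0" | "j = Suc k" | i where "j = Suc i" "i < k"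
      using j by (cases j) (auto simp: le_less)
    then show ?thesis
    proof cases
      case 1
      have "A \<inter> nbrs E (t 0) = A"
        using A t_W[of _ 0] s_t[of 0 0] sym_iff by auto
      moreover have "s ` {..k} \<inter> nbrs E (t 0) \<subseteq> A"
        using s0A s_t[of _ 0] sym_iff by auto
      ultimately have "thick A \<inter> nbrs E (t 0) = A" using tt[of 0] unfolding thick_def by blast
      then show ?thesis using Suc.prems 1 by simp
    next
      case 2
      have A': "(A - {s 0}) \<inter> nbrs E (t (Suc k)) = A - {s 0}"
        using A t_W[of _ "Suc k"] sym_iff by auto
      have s': "s ` {..k} \<inter> nbrs E (t (Suc k)) = {s k}"
        using s_t[of _ "Suc k"] sym_iff by auto
      have "thick A = (A - {s 0}) \<union> s ` {..k} \<union> t ` {..Suc k}"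
        unfolding thick_def by auto
      then have lk: "thick A \<inter> nbrs E (t (Suc k)) = (A - {s 0}) \<union> {s k}"
        using A' s' tt[of "Suc k"] by (simp only: Int_Un_distrib2 order.refl Un_empty_right)
      \<comment> \<open>Exchanging \<open>s 0\<close> for \<open>s k\<close> is an isomorphism,
        since all layers have the same neighbours in \<open>W\<close>.\<close>
      define f where "f x = (if x = s 0 then s k else x)" for x
      have img: "(A - {s 0}) \<union> {s k} = f ` A" using s0A by (auto simp: f_def)
      have "inj_on f A"
        using A s_in_W_iff[of k] unfolding inj_on_def f_def by (auto split: if_splits)
      moreover have "E (f x) (f y) = E x y" if "x \<in> A" "y \<in> A" for x y
      proof -
        have "E x (s k) = E x (s 0)" "E (s k) y = E (s 0) y"
          using that A s_W[of x k] s_W[of y k] sym_iff[of _ y] by auto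
        then show ?thesis using irrefl unfolding f_def by auto
      qed
      ultimately have "manifold_set E (Suc n) (f ` A)"
        using manifold_set_image Suc.prems(3) by blast
      then show ?thesis using lk img 2 by simp
    next
      case (3 i)
      have A': "(A - {s 0}) \<inter> nbrs E (t j) = ?B"
        using A t_W[of _ j] 3 irrefl[of "s 0"] sym_iff by auto
      have s': "s ` {..k} \<inter> nbrs E (t j) = {s i, s j}"
        using s_t[of _ j] 3 sym_iff by auto
      have "thick A = (A - {s 0}) \<union> s ` {..k} \<union> t ` {..Suc k}"
        unfolding thick_def by auto
      then have lk: "thick A \<inter> nbrs E (t j) = ?B \<union> {s i, s j}"
        using A' s' tt[of j] j by (simp only: Int_Un_distrib2 Un_empty_right)
      have "s i \<notin> ?B" "s j \<notin> ?B" using s_s[of 0 i] s_s[of 0 j] 3 by auto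
      then have "manifold_set E (Suc n) (?B \<union> {s i, s j})"
        using A B 3 s_eq_iff[of i j] s_s[of i] s_s[of j] s_W[of _ i] s_W[of _ j] sym_iff
        by (intro manifold_set_suspension) auto
      then show ?thesis using lk by simp
    qed
  qed
  have s_links: "manifold_set E (Suc n) (thick A \<inter> nbrs E (s j))" if j: "j \<le> k" for j
  proof -
    have "A \<inter> nbrs E (s j) = ?B" using A j s_W[of _ j] sym_iff by auto
    moreover have "t ` {..Suc k} \<inter> nbrs E (s j) = {t j, t (Suc j)}" using s_t[of j] j by auto
    ultimately have lk: "thick A \<inter> nbrs E (s j) = ?B \<union> {t j, t (Suc j)}"
      using ss[OF j] unfolding thick_def by blast
    have "E x (t j)" "E x (t (Suc j))" if "x \<in> ?B" for x
      using that A B_s[OF that] t_W[of x j] t_W[of x "Suc j"] j sym_iff[of x] by auto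
    then have "manifold_set E (Suc n) (?B \<union> {t j, t (Suc j)})"
      using A B j t_fresh[of j] t_fresh[of "Suc j"] t_eq_iff[of j "Suc j"] t_t[of j] t_t[of "Suc j"]
        sym_iff
      by (intro manifold_set_suspension) auto
    then show ?thesis using lk by simp
  qed
  have A_links: "manifold_set E (Suc n) (thick A \<inter> nbrs E v)" if v: "v \<in> A" "v \<noteq> s 0" for v
  proof (cases "E v (s 0)")
    case True
    have "thick A \<inter> nbrs E v = thick (A \<inter> nbrs E v)"
      using v A True s_W[of v] t_W[of v] unfolding thick_def by auto
    moreover have "n \<noteq> 0"
      using Suc.prems(3) v(1) True s0A by (cases n) auto
    then have "manifold_set E (Suc n) (thick (A \<inter> nbrs E v))"
      using Suc.prems v True by (intro Suc.IH) auto
    ultimately show ?thesis by simp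
  next
    case False
    have "s ` {..k} \<inter> nbrs E v = {}" using v A s_W[of v] False by auto
    moreover have "t ` {..Suc k} \<inter> nbrs E v = {t 0, t (Suc k)}"
      using v A t_W[of v] False by auto
    ultimately have "thick A \<inter> nbrs E v = (A \<inter> nbrs E v) \<union> {t 0, t (Suc k)}"
      unfolding thick_def by blast
    moreover have "manifold_set E (Suc n) ((A \<inter> nbrs E v) \<union> {t 0, t (Suc k)})"
      using Suc.prems v False by (intro suspension_tops) auto
    ultimately show ?thesis by simp
  qed
  have "sphere_set E (Suc (Suc n)) (thick A)"
  \<comment> \<open>Puncturing the sphere at the outer cell \<open>t 0\<close> leaves a ball that
    can be peeled layer by layer.\<close>
  proof (rule sphere_set.vertex[of "t 0"])
    have "t ` {..Suc k} = insert (t 0) (t ` {Suc 0..Suc k})"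
      by (metis atLeast0AtMost atLeastAtMost_insertL image_insert le0)
    moreover have "t 0 \<notin> t ` {Suc 0..Suc k}" using t_eq_iff by auto
    moreover have "t 0 \<notin> A" using A t_fresh[of 0] by auto
    moreover have "t 0 \<notin> s ` {..k}" using s_neq_t[of _ 0] by force
    moreover have "A \<union> s ` {..k} = (A - {s 0}) \<union> s ` {0..k}" by (auto simp: atLeast0AtMost)
    ultimately have "thick A - {t 0} = upper_layers A 0"
      unfolding thick_def upper_layers_def by blast
    then show "nonevasive E (thick A - {t 0})"
      using nonevasive_upper_layers[OF A, of 0] by simp
    show "sphere_set E (Suc n) (thick A \<inter> nbrs E (t 0))"
      using t_links[of 0] by (intro manifold_set_sphere) simp
  qed (simp add: thick_def)
  moreover have "manifold_set E (Suc n) (thick A \<inter> nbrs E v)" if v: "v \<in> thick A" for v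
  proof -
    from v consider "v \<in> A" "v \<noteq> s 0" | j where "j \<le> k" "v = s j" | j where "j \<le> Suc k" "v = t j"
      unfolding thick_def by blast
    then show ?thesis using t_links s_links A_links by cases blast+
  qed
  ultimately show ?case unfolding manifold_set.simps(2)[of E "Suc n"] by blast
qed

end

section \<open>Homology of the certified spheres\<close>

context finite_order
begin

lemma order_vertexI: "A \<subseteq> Field r \<Longrightarrow> v \<in> A \<Longrightarrow> order_vertex r A v"
  by (intro order_vertex.intro order_vertex_axioms.intro finite_order_axioms)

lemma exact_at_nonevasive:
  "nonevasive (comparable r) A \<Longrightarrow> A \<subseteq> Field r \<Longrightarrow> exact_at TYPE('k::field) r A i"
proof (induction arbitrary: i rule: nonevasive.induct)
  case (cone v A)
  then interpret order_vertex r A v by (intro order_vertexI)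
  show ?case using cone.hyps(2) by (rule exact_cone)
next
  case (delete v A)
  then interpret order_vertex r A v by (intro order_vertexI)
  show ?case using delete.IH delete.prems by (intro exact_at_from_link) auto
qed

lemma chains_in_empty: "chains_in r {} = {{}}"
  unfolding chains_in_def Chains_def by auto

lemma exact_at_empty: "i \<noteq> -1 \<Longrightarrow> exact_at TYPE('k::field) r {} i"
  unfolding exact_at_def
proof (intro ballI impI)
  fix c :: "'a set \<Rightarrow> 'k" assume "i \<noteq> -1" "c \<in> order_chains r {} i"
  then have "c = (\<lambda>_. 0)"
    unfolding simplicial_chains_def chains_in_empty by fastforce
  then show "\<exists>b \<in> order_chains r {} (i + 1). chain_boundary r b = c"
    by (intro bexI[of _ "\<lambda>_. 0"]) simp_all
qed

text \<open>The sphere of dimension -1: the empty set is the only face, nothing bounds it, and its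
  coefficient is the required functional.\<close>

lemma line_at_empty: "line_at TYPE('k::field) r {} (-1)"
  unfolding line_at_def
proof (intro exI[of _ "\<lambda>c. c {}"] conjI allI ballI impI)
  fix a :: 'k
  let ?x = "\<lambda>F. if F = {} then a else 0"
  have "?x \<in> order_chains r {} (-1)"
    unfolding simplicial_chains_def chains_in_empty by simp
  moreover have "chain_boundary r ?x = (\<lambda>_. 0)"
    unfolding chain_boundary_def by auto
  ultimately show "\<exists>x \<in> order_chains r {} (-1). chain_boundary r x = (\<lambda>_. 0) \<and> x {} = a"
    by (intro bexI[of _ ?x]) simp_all
next
  fix x :: "'a set \<Rightarrow> 'k"
  assume x: "x \<in> order_chains r {} (-1)"
  have x0: "x F = 0" if "F \<noteq> {}" for F
    using order_chains_zero[OF x] that unfolding chains_in_empty by blast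
  have "b = (\<lambda>_. 0)" if "b \<in> order_chains r {} (-1 + 1)" for b :: "'a set \<Rightarrow> 'k"
    using that unfolding simplicial_chains_def chains_in_empty by fastforce
  then have "(\<exists>b \<in> order_chains r {} (-1 + 1). chain_boundary r b = x) \<longleftrightarrow> x = (\<lambda>_. 0)"
    by (force intro!: bexI[of _ "\<lambda>_. 0"])
  also have "\<dots> \<longleftrightarrow> x {} = 0" using x0 unfolding fun_eq_iff by metis
  finally show "x {} = 0 \<longleftrightarrow> (\<exists>b \<in> order_chains r {} (-1 + 1). chain_boundary r b = x)" by simp
qed simp_all

text \<open>Each \<open>vertex\<close> step moves the homology of the link up by one degree,
  starting from degree -1.\<close>

lemma sphere_set_homology:
  "sphere_set (comparable r) n A \<Longrightarrow> A \<subseteq> Field r \<Longrightarrow>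
     line_at TYPE('k::field) r A (int n - 1) \<and> (\<forall>i. i \<noteq> int n - 1 \<longrightarrow> exact_at TYPE('k) r A i)"
proof (induction rule: sphere_set.induct)
  case empty
  then show ?case using line_at_empty[where 'k = 'k] exact_at_empty[where 'k = 'k] by simp
next
  case (vertex v A n)
  then interpret order_vertex r A v by (intro order_vertexI)
  have del: "exact_at TYPE('k) r (A - {v}) i" for i
    using vertex.hyps(2) vertex.prems by (intro exact_at_nonevasive) auto
  have IH: "line_at TYPE('k) r star_link (int n - 1)"
      "\<And>i. i \<noteq> int n - 1 \<Longrightarrow> exact_at TYPE('k) r star_link i"
    using vertex.IH vertex.prems by auto
  show ?case
    using line_at_from_link[OF del, of "int (Suc n) - 1"] exact_at_from_link[OF del] IH by force
qed

section \<open>Passage to the quotient groups, and links of faces\<close>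

lemma simplicial_cycles_eq:
  "simplicial_cycles r (chains_in r A) i =
     {c \<in> order_chains r A i. chain_boundary r c = (\<lambda>_. 0 :: 'k::field)}"
  unfolding simplicial_cycles_def by (auto simp: simplicial_boundary_eq)

lemma simplicial_boundaries_eq:
  "simplicial_boundaries r (chains_in r A) i =
     (chain_boundary r ` order_chains r A (i + 1) :: ('a set \<Rightarrow> 'k::field) set)"
  unfolding simplicial_boundaries_def by (intro image_cong HOL.refl simplicial_boundary_eq)

lemma cycle_diff:
  fixes x y :: "'a set \<Rightarrow> 'k::field"
  assumes "x \<in> simplicial_cycles r (chains_in r A) i" "y \<in> simplicial_cycles r (chains_in r A) i"
  shows "(\<lambda>F. x F - y F) \<in> simplicial_cycles r (chains_in r A) i"
proof -
  have "(\<lambda>F. x F - y F) = (\<lambda>F. x F + (-1) * y F)" by auto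
  moreover have "(\<lambda>F. x F + (-1) * y F) \<in> order_chains r A i"
    using assms unfolding simplicial_cycles_eq by (intro order_chains_add order_chains_scale) auto
  moreover have "chain_boundary r (\<lambda>F. x F + (-1) * y F) = (\<lambda>_. 0)"
    using assms unfolding simplicial_cycles_eq chain_boundary_add chain_boundary_scale by simp
  ultimately show ?thesis unfolding simplicial_cycles_eq by simp
qed

lemma homology_zero_of_exact:
  assumes "exact_at TYPE('k::field) r A i"
  shows "homology_zero TYPE('k) r (chains_in r A) i"
proof -
  let ?Z = "simplicial_cycles r (chains_in r A) i :: ('a set \<Rightarrow> 'k) set"
  have "x \<in> simplicial_boundaries r (chains_in r A) i" if "x \<in> ?Z" for x
    using assms that unfolding exact_at_def simplicial_boundaries_eq simplicial_cycles_eq by blast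
  then have "homologous_rel r (chains_in r A) i = ?Z \<times> ?Z"
    using cycle_diff unfolding homologous_rel_def by blast
  moreover have "(\<lambda>_. 0) \<in> ?Z" unfolding simplicial_cycles_eq by simp
  ultimately have "reduced_homology r (chains_in r A) i = {?Z}"
    unfolding reduced_homology_def quotient_def by auto
  then show ?thesis unfolding homology_zero_def by simp
qed

text \<open>The kernel of the functional on cycles consists of the boundaries, so homologous cycles
  are exactly those with equal values, and the functional descends to a bijection on
  classes.\<close>

lemma homology_field_of_line:
  assumes "line_at TYPE('k::field) r A i"
  shows "homology_field TYPE('k) r (chains_in r A) i"
proof -
  let ?Z = "simplicial_cycles r (chains_in r A) i :: ('a set \<Rightarrow> 'k) set"
  let ?H = "homologous_rel r (chains_in r A) i :: ('a set \<Rightarrow> 'k) rel"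
  obtain \<phi> :: "('a set \<Rightarrow> 'k) \<Rightarrow> 'k" where \<phi>:
      "\<And>x y. \<phi> (\<lambda>F. x F + y F) = \<phi> x + \<phi> y"
      "\<And>a x. \<phi> (\<lambda>F. a * x F) = a * \<phi> x"
      and onto: "\<And>a. \<exists>x \<in> order_chains r A i. chain_boundary r x = (\<lambda>_. 0) \<and> \<phi> x = a"
      and ker: "\<And>x. x \<in> order_chains r A i \<Longrightarrow> chain_boundary r x = (\<lambda>_. 0) \<Longrightarrow>
           \<phi> x = 0 \<longleftrightarrow> (\<exists>b \<in> order_chains r A (i + 1). chain_boundary r b = x)"
    using assms unfolding line_at_def by blast
  have onto': "\<exists>x \<in> ?Z. \<phi> x = a" for a
    using onto[of a] unfolding simplicial_cycles_eq by blast
  have ker': "\<phi> x = 0 \<longleftrightarrow> x \<in> simplicial_boundaries r (chains_in r A) i" if "x \<in> ?Z" for x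
    using that ker[of x] unfolding simplicial_cycles_eq simplicial_boundaries_eq by blast
  have diff: "\<phi> (\<lambda>F. x F - y F) = \<phi> x - \<phi> y" for x y
    using \<phi>(1)[of x "\<lambda>F. (-1) * y F"] \<phi>(2)[of "-1" y] by simp
  have H: "?H = {(x, y). x \<in> ?Z \<and> y \<in> ?Z \<and> \<phi> x = \<phi> y}"
    unfolding homologous_rel_def using ker'[OF cycle_diff] diff by auto
  define \<psi> where "\<psi> X = the_elem (\<phi> ` X)" for X
  have \<psi>: "\<psi> (?H `` {x}) = \<phi> x" if "x \<in> ?Z" for x
  proof -
    have "\<phi> ` (?H `` {x}) = {\<phi> x}" using that unfolding H by auto
    then show ?thesis unfolding \<psi>_def by simp
  qed
  have classes: "reduced_homology r (chains_in r A) i = (\<lambda>x. ?H `` {x}) ` ?Z"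
    unfolding reduced_homology_def quotient_def by auto
  have sums: "(\<lambda>F. x F + y F) \<in> ?Z" "(\<lambda>F. a * x F) \<in> ?Z" if "x \<in> ?Z" "y \<in> ?Z" for x y a
    using that unfolding simplicial_cycles_eq
    by (auto simp: chain_boundary_add chain_boundary_scale order_chains_add order_chains_scale)
  show ?thesis
    unfolding homology_field_def
  proof (intro exI[of _ \<psi>] conjI ballI allI)
    have "inj_on \<psi> ((\<lambda>x. ?H `` {x}) ` ?Z)"
    proof (rule inj_onI, clarify)
      fix x y assume "x \<in> ?Z" "y \<in> ?Z" "\<psi> (?H `` {x}) = \<psi> (?H `` {y})"
      then show "?H `` {x} = ?H `` {y}" using \<psi> unfolding H by auto
    qed
    moreover have "\<psi> ` (\<lambda>x. ?H `` {x}) ` ?Z = UNIV"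
      using \<psi> onto' by (auto simp: image_iff) metis
    ultimately show "bij_betw \<psi> (reduced_homology r (chains_in r A) i) UNIV"
      unfolding bij_betw_def classes by simp
  qed (simp_all add: \<psi> sums \<phi>)
qed

text \<open>The link of a face is an iterated vertex link, taken one vertex of \<open>F\<close> at a
  time.\<close>

lemma manifold_set_link:
  assumes "manifold_set (comparable r) n A" "A \<subseteq> Field r" "F \<in> chains_in r A"
  shows "card F \<le> n \<and> manifold_set (comparable r) (n - card F) {u \<in> A. \<forall>x \<in> F. comparable r x u}"
proof -
  have "finite F" using assms(3) by (rule finite_chain)
  then show ?thesis using assms(3)
  proof (induction F rule: finite_induct)
    case empty
    then show ?case using assms(1) by simp
  next
    case (insert x F)
    let ?L = "{u \<in> A. \<forall>x \<in> F. comparable r x u}"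
    have x: "x \<in> ?L" and F: "F \<in> chains_in r A"
      using insert.prems insert.hyps(2) assms(2) by (subst (asm) (1) chains_in_alt; auto simp: chains_in_alt)+
    note IH = insert.IH[OF F]
    \<comment> \<open>The link of \<open>F\<close> contains \<open>x\<close>, so it is not empty and
      its index cannot be 0; this also gives the bound on the cardinality.\<close>
    then obtain m where m: "n - card F = Suc m"
      using x by (cases "n - card F") auto
    then have "manifold_set (comparable r) m (?L \<inter> nbrs (comparable r) x)"
      using IH x by simp
    moreover have "?L \<inter> nbrs (comparable r) x = {u \<in> A. \<forall>y \<in> insert x F. comparable r y u}" by auto
    moreover have "m = n - card (insert x F)" "card (insert x F) \<le> n"
      using m insert.hyps by simp_all
    ultimately show ?case by simp
  qed
qed

text \<open>A chain that attains the bound on faces, which pins down the dimension; it grows by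
  passing to the link of an arbitrary vertex.\<close>

lemma manifold_set_chain:
  "manifold_set (comparable r) n A \<Longrightarrow> A \<subseteq> Field r \<Longrightarrow> \<exists>F \<in> chains_in r A. card F = n"
proof (induction n arbitrary: A)
  case 0
  then show ?case unfolding chains_in_def Chains_def by auto
next
  case (Suc n)
  then obtain v where v: "v \<in> A" by (auto elim: sphere_set.cases)
  then interpret order_vertex r A v using Suc.prems by (intro order_vertexI)
  obtain G where G: "G \<in> chains_in r star_link" "card G = n"
    using Suc.IH[of star_link] Suc.prems v by auto
  then have "v \<notin> G" "finite G" using star_link_subset finite_chain unfolding chains_in_def by blast+
  then show ?case using G insert_vertex_chain_iff[of G] by (intro bexI[of _ "insert v G"]) auto
qed

text \<open>The complex of chains is a flag complex, so the link of \<open>F\<close> is again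
  described by a vertex set, the common neighbours of \<open>F\<close>. Irreflexivity of
  comparability makes the faces of the link disjoint from \<open>F\<close>.\<close>

lemma link_chains_in:
  assumes "F \<in> chains_in r A" "A \<subseteq> Field r"
  shows "link (chains_in r A) F = chains_in r {u \<in> A. \<forall>x \<in> F. comparable r x u}"
proof -
  have "{u \<in> A. \<forall>x \<in> F. comparable r x u} \<subseteq> Field r" using assms(2) by blast
  note alt = chains_in_alt[OF this] chains_in_alt[OF assms(2)]
  have F: "F \<subseteq> A" "\<And>x y. x \<in> F \<Longrightarrow> y \<in> F \<Longrightarrow> x \<noteq> y \<Longrightarrow> comparable r x y"
    using assms(1) alt(2) by auto
  have sym: "comparable r x y \<longleftrightarrow> comparable r y x" and irrefl: "\<not> comparable r x x" for x y
    unfolding comparable_def by auto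
  show ?thesis
    unfolding link_def
  proof (intro set_eqI, unfold mem_Collect_eq alt)
    fix G
    show "(G \<subseteq> A \<and> (\<forall>x\<in>G. \<forall>y\<in>G. x \<noteq> y \<longrightarrow> comparable r x y)) \<and> F \<inter> G = {} \<and>
             F \<union> G \<subseteq> A \<and> (\<forall>x\<in>F \<union> G. \<forall>y\<in>F \<union> G. x \<noteq> y \<longrightarrow> comparable r x y) \<longleftrightarrow>
          G \<subseteq> {u \<in> A. \<forall>x\<in>F. comparable r x u} \<and> (\<forall>x\<in>G. \<forall>y\<in>G. x \<noteq> y \<longrightarrow> comparable r x y)"
      (is "?l = ?r")
    proof
      assume ?l
      then have disj: "F \<inter> G = {}" and G: "G \<subseteq> A" and comp: "\<And>x y. x \<in> F \<union> G \<Longrightarrow> y \<in> F \<union> G \<Longrightarrow> x \<noteq> y \<Longrightarrow> comparable r x y"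
        by blast+
      have "comparable r x u" if "x \<in> F" "u \<in> G" for x u
        using disj that by (intro comp) auto
      then show ?r using G comp by blast
    next
      assume r: ?r
      then have "F \<inter> G = {}" using irrefl by blast
      moreover have "comparable r x y" if "x \<in> F \<union> G" "y \<in> F \<union> G" "x \<noteq> y" for x y
        using that r F(2) sym by blast
      ultimately show ?l using r F(1) by blast
    qed
  qed
qed

lemma complex_dim_manifold:
  assumes "manifold_set (comparable r) n A" "A \<subseteq> Field r"
  shows "complex_dim (chains_in r A) = int n - 1"
proof -
  have "finite (chains_in r A)"
    using assms(2) finite_Field by (auto simp: chains_in_def intro: finite_subset[of _ "Pow A"] finite_subset)
  then show ?thesis
    unfolding complex_dim_def
    using manifold_set_link[OF assms] manifold_set_chain[OF assms]
    by (intro Max_eqI) (fastforce simp: image_iff)+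
qed

lemma order_complex_eq: "order_complex r = chains_in r (Field r - {bottom r})"
  using Field_of_chain unfolding order_complex_def chains_in_def by blast

end

lemma gorenstein_star_manifold:
  assumes r: "finite_poset_bot r"
    and mf: "manifold_set (comparable r) n (Field r - {bottom r})"
  shows "gorenstein_star TYPE('k::field) r"
proof -
  interpret finite_order r using r by unfold_locales (auto simp: finite_poset_bot_def)
  let ?A = "Field r - {bottom r}"
  have "if i = complex_dim (order_complex r) - int (card F)
        then homology_field TYPE('k) r (link (order_complex r) F) i
        else homology_zero TYPE('k) r (link (order_complex r) F) i"
    if F: "F \<in> order_complex r" for F i
  proof -
    let ?L = "{u \<in> ?A. \<forall>x \<in> F. comparable r x u}"
    have FA: "F \<in> chains_in r ?A" using F order_complex_eq by simp
    have "card F \<le> n" and "manifold_set (comparable r) (n - card F) ?L"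
      using manifold_set_link[OF mf _ FA] by auto
    then have "line_at TYPE('k) r ?L (int (n - card F) - 1)"
        "i \<noteq> int (n - card F) - 1 \<Longrightarrow> exact_at TYPE('k) r ?L i"
      using sphere_set_homology[of "n - card F" ?L, where 'k = 'k] manifold_set_sphere by blast+
    moreover have "complex_dim (order_complex r) - int (card F) = int (n - card F) - 1"
      using complex_dim_manifold[OF mf] \<open>card F \<le> n\<close> order_complex_eq by auto
    moreover have "link (order_complex r) F = chains_in r ?L"
      using link_chains_in[OF FA] order_complex_eq by auto
    ultimately show ?thesis using homology_field_of_line homology_zero_of_exact by auto
  qed
  then show ?thesis using r unfolding gorenstein_star_def by blast
qed

section \<open>Non-commutative polynomials\<close>

lemma ncpoly_eq_sum:
  "(p :: 'x ncpoly) =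
     (\<Sum>w \<in> Poly_Mapping.keys p. Poly_Mapping.single w (Poly_Mapping.lookup p w))"
  by (rule poly_mapping_eqI)
    (simp add: lookup_sum lookup_single when_def sum.delta' in_keys_iff)

abbreviation coeff_word :: "'x ncpoly \<Rightarrow> 'x list \<Rightarrow> int" where
  "coeff_word p w \<equiv> Poly_Mapping.lookup p (Word w)"

lemma Word_eq_snoc_iff: "u + Word [x] = Word (v @ [y]) \<longleftrightarrow> u = Word v \<and> x = y"
  by (cases u) (auto simp: plus_free_monoid_def)

lemma Word_neq_snoc: "u + Word [x] \<noteq> Word []"
  by (cases u) (auto simp: plus_free_monoid_def)

lemma coeff_word_mult_var:
  "coeff_word (p * nc_var x) [] = 0"
  "coeff_word (p * nc_var x) (v @ [y]) = (if x = y then coeff_word p v else 0)"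
proof -
  have prod: "p * nc_var x =
      (\<Sum>w \<in> Poly_Mapping.keys p. Poly_Mapping.single (w + Word [x]) (Poly_Mapping.lookup p w))"
    by (subst ncpoly_eq_sum[of p]) (simp add: nc_var_def sum_distrib_right mult_single)
  show "coeff_word (p * nc_var x) [] = 0"
    unfolding prod by (simp add: lookup_sum lookup_single when_def Word_neq_snoc)
  show "coeff_word (p * nc_var x) (v @ [y]) = (if x = y then coeff_word p v else 0)"
    unfolding prod
    by (simp add: lookup_sum lookup_single when_def Word_eq_snoc_iff sum.delta' in_keys_iff)
qed

lemma nc_subst_superset:
  assumes "finite A" "Poly_Mapping.keys p \<subseteq> A"
  shows "nc_subst g p =
           (\<Sum>w \<in> A. of_int (Poly_Mapping.lookup p w) * prod_list (map g (letters w)))"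
  unfolding nc_subst_def using assms by (intro sum.mono_neutral_left) (auto simp: in_keys_iff)

lemma nc_subst_add: "nc_subst g (p + q) = nc_subst g p + nc_subst g q"
proof -
  let ?A = "Poly_Mapping.keys p \<union> Poly_Mapping.keys q"
  have "Poly_Mapping.keys (p + q) \<subseteq> ?A" by (rule keys_add)
  then show ?thesis
    by (simp add: nc_subst_superset[of ?A] lookup_add sum.distrib distrib_right)
qed

lemma nc_subst_sum: "nc_subst g (\<Sum>i \<in> I. p i) = (\<Sum>i \<in> I. nc_subst g (p i))"
  by (induction I rule: infinite_finite_induct) (simp_all add: nc_subst_add, simp_all add: nc_subst_def)

lemma nc_subst_single:
  "nc_subst g (Poly_Mapping.single w k) = of_int k * prod_list (map g (letters w))"
  by (subst nc_subst_superset[of "{w}"]) simp_all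

lemma nc_subst_one: "nc_subst (g :: 'x \<Rightarrow> _) 1 = 1"
proof -
  have "letters 0 = ([] :: 'x list)" by (simp add: zero_free_monoid_def)
  then show ?thesis using nc_subst_single[of g "0 :: 'x free_monoid" 1] by simp
qed

text \<open>Multiplicativity in the form that suits the recursion for the cd-polynomials, which
  appends one letter at a time.\<close>

lemma nc_subst_mult_var: "nc_subst g (p * nc_var x) = nc_subst g p * g x"
proof -
  have "p * nc_var x =
      (\<Sum>w \<in> Poly_Mapping.keys p. Poly_Mapping.single (w + Word [x]) (Poly_Mapping.lookup p w))"
    by (subst ncpoly_eq_sum[of p]) (simp add: nc_var_def sum_distrib_right mult_single)
  then have "nc_subst g (p * nc_var x) =
      (\<Sum>w \<in> Poly_Mapping.keys p. of_int (Poly_Mapping.lookup p w) * prod_list (map g (letters (w + Word [x]))))"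
    by (simp only: nc_subst_sum nc_subst_single)
  then show ?thesis
    by (simp add: plus_free_monoid_def nc_subst_def sum_distrib_right mult.assoc)
qed

lemma nc_subst_of_nat: "nc_subst g (of_nat k * p) = of_nat k * nc_subst g p"
  by (induction k) (simp_all add: nc_subst_add distrib_right, simp add: nc_subst_def)

text \<open>
  If \<open>\<Psi> = Q (a + b) + S (ab + ba)\<close>, then the coefficient of \<open>v\<close> in \<open>S\<close> is that of \<open>vba\<close> minus
  that of \<open>vbb\<close> in \<open>\<Psi>\<close>, and \<open>Q + S b\<close> is read off at the words ending in \<open>a\<close>. Iterating this,
  the coefficients of a cd-polynomial are recovered from its expansion. The cd-word is given
  in reverse.
\<close>

fun recover_coeff :: "cd list \<Rightarrow> (ab list \<Rightarrow> int) \<Rightarrow> int" where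
  "recover_coeff [] f = f []"
| "recover_coeff (LD # w) f = recover_coeff w (\<lambda>v. f (v @ [LB, LA]) - f (v @ [LB, LB]))"
| "recover_coeff (LC # w) f = recover_coeff w (\<lambda>u. f (u @ [LA]) -
     (if u \<noteq> [] \<and> last u = LB then f (butlast u @ [LB, LA]) - f (butlast u @ [LB, LB]) else 0))"

lemma recover_coeff_add:
  "recover_coeff w (\<lambda>u. f u + g u) = recover_coeff w f + recover_coeff w g"
proof (induction w f arbitrary: g rule: recover_coeff.induct)
  case (2 w f)
  show ?case
    unfolding recover_coeff.simps 2[symmetric] by (rule arg_cong[of _ _ "recover_coeff w"]) auto
next
  case (3 w f)
  show ?case
    unfolding recover_coeff.simps 3[symmetric] by (rule arg_cong[of _ _ "recover_coeff w"]) auto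
qed simp

lemma recover_coeff_scale: "recover_coeff w (\<lambda>u. k * f u) = k * recover_coeff w f"
proof (induction w f rule: recover_coeff.induct)
  case (3 w f)
  show ?case
    unfolding recover_coeff.simps 3[symmetric]
    by (rule arg_cong[of _ _ "recover_coeff w"]) (auto simp: algebra_simps)
qed (simp_all add: right_diff_distrib[symmetric])

lemma recover_coeff_zero: "recover_coeff w (\<lambda>_. 0) = 0"
  using recover_coeff_scale[of w 0 "\<lambda>_. 0"] by simp

lemma recover_coeff_sum:
  "recover_coeff w (\<lambda>u. \<Sum>i \<in> I. f i u) = (\<Sum>i \<in> I. recover_coeff w (f i))"
  by (induction I rule: infinite_finite_induct) (simp_all add: recover_coeff_zero recover_coeff_add)

lemma coeff_word_mult_c:
  "coeff_word (p * cd_to_ab LC) [] = 0"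
  "coeff_word (p * cd_to_ab LC) (u @ [x]) = coeff_word p u"
  by (cases x; simp add: distrib_left lookup_add coeff_word_mult_var)+

lemma coeff_word_mult_d:
  "coeff_word (p * cd_to_ab LD) [] = 0"
  "coeff_word (p * cd_to_ab LD) [x] = 0"
  "coeff_word (p * cd_to_ab LD) (u @ [x, y]) = (if x = y then 0 else coeff_word p u)"
proof -
  have eq: "p * cd_to_ab LD = p * nc_var LA * nc_var LB + p * nc_var LB * nc_var LA"
    by (simp add: distrib_left mult.assoc)
  show "coeff_word (p * cd_to_ab LD) [] = 0"
    unfolding eq by (simp add: lookup_add coeff_word_mult_var)
  show "coeff_word (p * cd_to_ab LD) [x] = 0"
    unfolding eq lookup_add using coeff_word_mult_var(2)[of _ _ "[]" x]
    by (simp add: coeff_word_mult_var(1))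
  show "coeff_word (p * cd_to_ab LD) (u @ [x, y]) = (if x = y then 0 else coeff_word p u)"
    unfolding eq lookup_add using coeff_word_mult_var(2)[of _ _ "u @ [x]" y]
    by (cases x; cases y; simp add: coeff_word_mult_var(2))
qed

text \<open>The functionals \<open>recover_coeff (rev w)\<close> are dual to the expanded
  cd-monomials. Equal last letters are stripped from both sides; different last letters already
  yield the zero function.\<close>

lemma recover_coeff_monomial:
  "recover_coeff (rev w) (coeff_word (prod_list (map cd_to_ab w'))) = (if w = w' then 1 else 0)"
proof (induction w' arbitrary: w rule: rev_induct)
  case Nil
  have one: "coeff_word 1 u = (if u = [] then 1 else 0)" for u :: "ab list"
    by (simp add: lookup_one zero_free_monoid_def when_def)
  show ?case
  proof (cases w rule: rev_cases)
    case Nil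
    then show ?thesis by (simp add: one)
  next
    case (snoc u x)
    then show ?thesis by (cases x) (simp_all add: one recover_coeff_zero cong: if_cong)
  qed
next
  case (snoc x' w')
  let ?p = "prod_list (map cd_to_ab w')"
  have prod: "prod_list (map cd_to_ab (w' @ [x'])) = ?p * cd_to_ab x'" by simp
  show ?case
  proof (cases w rule: rev_cases)
    case Nil
    then show ?thesis
      unfolding prod by (cases x') (simp_all only: rev.simps recover_coeff.simps
          coeff_word_mult_c coeff_word_mult_d append_is_Nil_conv not_Cons_self2 if_False list.simps, simp_all)
  next
    case w: (snoc u x)
    have c_snoc2: "coeff_word (?p * cd_to_ab LC) (v @ [a, b]) = coeff_word ?p (v @ [a])" for v a b
      using coeff_word_mult_c(2)[of ?p "v @ [a]" b] by simp
    show ?thesis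
    proof (cases x; cases x')
      assume x: "x = LC" "x' = LC"
      show ?thesis
        unfolding prod w x using snoc.IH[of u]
        by (simp add: coeff_word_mult_c(2) c_snoc2 del: cd_to_ab.simps cong: if_cong)
    next
      assume x: "x = LD" "x' = LC"
      show ?thesis
        unfolding prod w x
        by (simp add: c_snoc2 recover_coeff_zero del: cd_to_ab.simps)
    next
      assume x: "x = LD" "x' = LD"
      show ?thesis
        unfolding prod w x using snoc.IH[of u]
        by (simp add: coeff_word_mult_d(3) del: cd_to_ab.simps)
    next
      assume x: "x = LC" "x' = LD"
      \<comment> \<open>In an expansion ending in d, words ending in aa or bb have coefficient 0,
        and a word ending in ba is cancelled by the subtracted term.\<close>
      have "coeff_word (?p * cd_to_ab LD) (v @ [LA]) -
          (if v \<noteq> [] \<and> last v = LB then coeff_word (?p * cd_to_ab LD) (butlast v @ [LB, LA]) -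
             coeff_word (?p * cd_to_ab LD) (butlast v @ [LB, LB]) else 0) = 0" for v
      proof (cases v rule: rev_cases)
        case Nil
        then show ?thesis using coeff_word_mult_d(2)[of ?p LA] by (simp del: cd_to_ab.simps)
      next
        case (snoc v' y)
        then show ?thesis
          using coeff_word_mult_d(3)[of ?p v' y LA] coeff_word_mult_d(3)[of ?p v' LB LB]
          by (cases y) (simp_all del: cd_to_ab.simps)
      qed
      then show ?thesis
        unfolding prod w x by (simp add: recover_coeff_zero del: cd_to_ab.simps)
    qed
  qed
qed

lemma lookup_of_nat_times: "Poly_Mapping.lookup (of_nat k * p) w = of_nat k * Poly_Mapping.lookup p w"
  for p :: "'x ncpoly"
  by (induction k) (simp_all add: lookup_add distrib_right)

lemma recover_coeff_nc_subst:
  "recover_coeff (rev w) (coeff_word (nc_subst cd_to_ab p)) = coeff_word p w"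
proof -
  have scale: "Poly_Mapping.lookup (of_int k * q) u = k * Poly_Mapping.lookup q u"
    for k and q :: "ab ncpoly" and u
    by (cases k rule: int_cases2) (simp_all add: lookup_of_nat_times)
  have "coeff_word (nc_subst cd_to_ab p) =
      (\<lambda>u. \<Sum>v \<in> Poly_Mapping.keys p.
         Poly_Mapping.lookup p v * coeff_word (prod_list (map cd_to_ab (letters v))) u)"
    by (auto simp: nc_subst_def lookup_sum scale)
  then have "recover_coeff (rev w) (coeff_word (nc_subst cd_to_ab p)) =
      (\<Sum>v \<in> Poly_Mapping.keys p. Poly_Mapping.lookup p v * (if w = letters v then 1 else 0))"
    by (simp add: recover_coeff_sum recover_coeff_scale recover_coeff_monomial)
  also have "\<dots> = (\<Sum>v \<in> Poly_Mapping.keys p. if v = Word w then Poly_Mapping.lookup p v else 0)"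
    by (intro sum.cong) (auto simp: free_monoid.expand)
  also have "\<dots> = coeff_word p w"
    by (simp add: in_keys_iff)
  finally show ?thesis .
qed

text \<open>The uniqueness behind the definite description in \<open>cd_index\<close>: every
  coefficient is recovered from the expansion.\<close>

lemma inj_nc_subst_cd_to_ab: "inj (nc_subst cd_to_ab)"
proof (rule injI, rule poly_mapping_eqI)
  fix p q and w :: "cd free_monoid"
  assume "nc_subst cd_to_ab p = nc_subst cd_to_ab q"
  then show "Poly_Mapping.lookup p w = Poly_Mapping.lookup q w"
    using recover_coeff_nc_subst[of "letters w" p] recover_coeff_nc_subst[of "letters w" q] by simp
qed

lemma cd_index_eqI: "nc_subst cd_to_ab \<Phi> = ab_index r \<Longrightarrow> cd_index r = \<Phi>"
  unfolding cd_index_def using inj_nc_subst_cd_to_ab by (auto simp: inj_def intro!: the_equality)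

section \<open>The cd-polynomials with multiplicative coefficients\<close>

text \<open>The recurrence by the last letter. In degree n+2 a final d follows a word of degree n
  and contributes n+1 to \<open>kappa\<close>, whence the factor
  \<open>\<alpha> (Suc n)\<close>.\<close>

fun multiplicative_cd :: "(nat \<Rightarrow> nat) \<Rightarrow> nat \<Rightarrow> cd ncpoly" where
  "multiplicative_cd \<alpha> 0 = 1"
| "multiplicative_cd \<alpha> (Suc 0) = nc_var LC"
| "multiplicative_cd \<alpha> (Suc (Suc n)) =
     multiplicative_cd \<alpha> (Suc n) * nc_var LC +
     of_nat (\<alpha> (Suc n)) * multiplicative_cd \<alpha> n * nc_var LD"

lemma cd_degree_snoc:
  "cd_degree (u @ [LC]) = Suc (cd_degree u)" "cd_degree (u @ [LD]) = Suc (Suc (cd_degree u))"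
  by (simp_all add: cd_degree_def)

lemma kappa_snoc:
  "kappa (Word (u @ [LC])) = kappa (Word u)"
  "kappa (Word (u @ [LD])) = insert (Suc (cd_degree u)) (kappa (Word u))"
  using kappa_append[of u "[LC]"] kappa_append[of u "[LD]"] kappa_replicate_c[of 1] kappa_d_c[of 0]
  by auto

lemma kappa_subset: "kappa (Word w) \<subseteq> {1..<cd_degree w}"
proof (induction w rule: rev_induct)
  case Nil
  then show ?case using kappa_replicate_c[of 0] by simp
next
  case (snoc x w)
  then show ?case by (cases x) (auto simp: kappa_snoc cd_degree_snoc)
qed

lemma coeff_multiplicative_cd:
  "cd_degree w = n \<Longrightarrow> coeff_word (multiplicative_cd \<alpha> n) w = (\<Prod>i \<in> kappa (Word w). int (\<alpha> i))"
proof (induction \<alpha> n arbitrary: w rule: multiplicative_cd.induct)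
  case (1 \<alpha>)
  then have "w = []" using cd_degree_snoc by (cases w rule: rev_cases) (metis cd.exhaust nat.distinct(1))+
  then show ?case using kappa_replicate_c[of 0] by (simp add: lookup_one zero_free_monoid_def)
next
  case (2 \<alpha>)
  then obtain u x where w: "w = u @ [x]" by (cases w rule: rev_cases) (auto simp: cd_degree_def)
  then have x: "x = LC" using 2 cd_degree_snoc(2) by (cases x) auto
  then have "cd_degree u = 0" using 2 w cd_degree_snoc(1) by simp
  then have "u = []" using cd_degree_snoc by (cases u rule: rev_cases) (metis cd.exhaust nat.distinct(1))+
  then show ?case using w x kappa_replicate_c[of 1] by (simp add: nc_var_def)
next
  case (3 \<alpha> n)
  then obtain u x where w: "w = u @ [x]" by (cases w rule: rev_cases) (auto simp: cd_degree_def)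
  show ?case
  proof (cases x)
    case LC
    then have "cd_degree u = Suc n" using 3 w cd_degree_snoc(1) by simp
    then show ?thesis
      using 3(1)[of u] LC w by (simp add: lookup_add coeff_word_mult_var kappa_snoc)
  next
    case LD
    then have u: "cd_degree u = n" using 3 w cd_degree_snoc(2) by simp
    \<comment> \<open>The set of \<open>u\<close> stays below its degree \<open>n\<close>, so the
      factor for \<open>Suc n\<close> splits off the product.\<close>
    have "finite (kappa (Word u))" "Suc n \<notin> kappa (Word u)"
      using kappa_subset[of u] u by (auto intro: finite_subset)
    then show ?thesis
      using 3(2)[OF u] LD w u
      by (simp add: lookup_add coeff_word_mult_var kappa_snoc lookup_of_nat_times)
  qed
qed

text \<open>The largest element allowed, n-1, decides the last letter: if it is present, then n-2 is
  absent and the monomial ends in d; otherwise it ends in c.\<close>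

lemma sparse_set_kappa: "S \<in> sparse_sets n \<Longrightarrow> \<exists>w. cd_degree w = n \<and> kappa (Word w) = S"
proof (induction n arbitrary: S rule: less_induct)
  case (less n)
  show ?case
  proof (cases "n = 0 \<or> n = Suc 0")
    case True
    then have "S = {}" using less.prems by (auto simp: sparse_sets_def)
    moreover have "cd_degree (replicate n LC) = n" using True by (auto simp: cd_degree_def)
    ultimately show ?thesis using kappa_replicate_c[of n] by blast
  next
    case False
    then obtain m where n: "n = Suc (Suc m)" by (metis not0_implies_Suc)
    show ?thesis
    proof (cases "Suc m \<in> S")
      case True
      then have "m \<notin> S" using less.prems unfolding sparse_sets_def by blast
      have "x \<in> {1..<m}" if "x \<in> S - {Suc m}" for x
      proof -
        have "x \<noteq> m" "x \<noteq> Suc m" "x \<in> {1..<Suc (Suc m)}"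
          using that \<open>m \<notin> S\<close> less.prems unfolding n sparse_sets_def by auto
        then show ?thesis by auto
      qed
      then have "S - {Suc m} \<in> sparse_sets m"
        using less.prems unfolding sparse_sets_def by blast
      then obtain w where "cd_degree w = m" "kappa (Word w) = S - {Suc m}"
        using less.IH[of m] n by auto
      then show ?thesis
        using True n by (intro exI[of _ "w @ [LD]"]) (auto simp: kappa_snoc cd_degree_snoc)
    next
      case False
      then have "S \<in> sparse_sets (Suc m)"
        using less.prems unfolding n sparse_sets_def by (auto simp: less_Suc_eq)
      then obtain w where "cd_degree w = Suc m" "kappa (Word w) = S"
        using less.IH[of "Suc m"] n by auto
      then show ?thesis
        using n by (intro exI[of _ "w @ [LC]"]) (auto simp: kappa_snoc cd_degree_snoc)
    qed
  qed
qed

text \<open>The coefficient of a monomial is a function of its \<open>kappa\<close> set, so it can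
  be evaluated at the preimage chosen by \<open>inv_into\<close>.\<close>

lemma cd_coeff_multiplicative:
  assumes "nc_subst cd_to_ab (multiplicative_cd \<alpha> n) = ab_index r" "poset_rank r = n"
    and "S \<in> sparse_sets n"
  shows "cd_coeff r S = (\<Prod>i \<in> S. int (\<alpha> i))"
proof -
  let ?w = "inv_into (cd_monomials n) kappa S"
  obtain w where "cd_degree w = n" "kappa (Word w) = S" using sparse_set_kappa[OF assms(3)] by blast
  then have "S \<in> kappa ` cd_monomials n" by (force simp: cd_monomials_def)
  then have "?w \<in> cd_monomials n" "kappa ?w = S" by (rule inv_into_into, rule f_inv_into_f)
  then show ?thesis
    using coeff_multiplicative_cd[of "letters ?w" n \<alpha>] cd_index_eqI[OF assms(1)] assms(2)
    by (simp add: cd_coeff_def cd_monomials_def)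
qed

section \<open>The ab-polynomial of a flag vector\<close>

definition alternating_sum :: "(nat set \<Rightarrow> int) \<Rightarrow> nat set \<Rightarrow> int" where
  "alternating_sum f S = (\<Sum>T \<in> Pow S. (-1) ^ (card S - card T) * f T)"

text \<open>Taken for arbitrary functions of the rank set, so that flag vectors of different posets
  can be added and scaled; the polynomial is linear in \<open>f\<close>.\<close>

definition ab_poly :: "nat \<Rightarrow> (nat set \<Rightarrow> int) \<Rightarrow> ab ncpoly" where
  "ab_poly n f = (\<Sum>S \<in> Pow {1..n}. Poly_Mapping.single (ab_word n S) (alternating_sum f S))"

lemma ab_index_eq: "ab_index r = ab_poly (poset_rank r) (\<lambda>T. int (flag_f r T))"
  unfolding ab_index_def ab_poly_def alternating_sum_def flag_h_def ..

lemma sum_Pow_insert: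
  assumes "finite A" "x \<notin> A"
  shows "sum f (Pow (insert x A)) = sum f (Pow A) + (\<Sum>T \<in> Pow A. f (insert x T))"
proof -
  have "sum f (Pow (insert x A)) = sum f (Pow A) + sum f (insert x ` Pow A)"
    unfolding Pow_insert using assms by (intro sum.union_disjoint) auto
  moreover have "inj_on (insert x) (Pow A)"
    using assms(2) by (intro inj_onI) (metis PowD insert_ident subsetD)
  ultimately show ?thesis by (simp add: sum.reindex)
qed

lemma alternating_sum_insert:
  assumes "finite S" "m \<notin> S"
  shows "alternating_sum f (insert m S) = alternating_sum (\<lambda>T. f (insert m T) - f T) S"
proof -
  have "(-1) ^ (card (insert m S) - card T) * f T +
          (-1) ^ (card (insert m S) - card (insert m T)) * f (insert m T) =
        (-1) ^ (card S - card T) * (f (insert m T) - f T)"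
    if T: "T \<in> Pow S" for T
  proof -
    have "finite T" "m \<notin> T" "card T \<le> card S"
      using T assms by (auto intro: finite_subset card_mono)
    then show ?thesis using assms by (simp add: Suc_diff_le algebra_simps)
  qed
  then show ?thesis
    unfolding alternating_sum_def sum_Pow_insert[OF assms] sum.distrib[symmetric]
    by (intro sum.cong) auto
qed

lemma ab_word_Suc: "ab_word (Suc n) S = ab_word n S + Word [if Suc n \<in> S then LB else LA]"
  by (simp add: ab_word_def plus_free_monoid_def)

lemma ab_word_insert_Suc: "ab_word n (insert (Suc n) S) = ab_word n S"
  by (simp add: ab_word_def)

text \<open>The words are split by the letter at the top rank. In front of b, the terms for
  \<open>T\<close> and \<open>insert (Suc n) T\<close> pair up to a difference.\<close>

lemma ab_poly_Suc:
  "ab_poly (Suc n) f =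
     ab_poly n f * nc_var LA + ab_poly n (\<lambda>T. f (insert (Suc n) T) - f T) * nc_var LB"
proof -
  have "Pow {1..Suc n} = Pow (insert (Suc n) {1..n})"
    by (simp add: atLeastAtMostSuc_conv)
  then have "ab_poly (Suc n) f =
      (\<Sum>S \<in> Pow {1..n}. Poly_Mapping.single (ab_word (Suc n) S) (alternating_sum f S)) +
      (\<Sum>S \<in> Pow {1..n}. Poly_Mapping.single (ab_word (Suc n) (insert (Suc n) S))
         (alternating_sum f (insert (Suc n) S)))"
    unfolding ab_poly_def by (simp add: sum_Pow_insert)
  moreover have "Poly_Mapping.single (ab_word (Suc n) S) (alternating_sum f S) =
      Poly_Mapping.single (ab_word n S) (alternating_sum f S) * nc_var LA"
    if "S \<in> Pow {1..n}" for S
    using that by (auto simp: ab_word_Suc nc_var_def mult_single)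
  moreover have "Poly_Mapping.single (ab_word (Suc n) (insert (Suc n) S))
         (alternating_sum f (insert (Suc n) S)) =
      Poly_Mapping.single (ab_word n S) (alternating_sum (\<lambda>T. f (insert (Suc n) T) - f T) S) * nc_var LB"
    if "S \<in> Pow {1..n}" for S
  proof -
    have "finite S" "Suc n \<notin> S" using that by (auto intro: finite_subset)
    then show ?thesis
      by (simp add: ab_word_Suc ab_word_insert_Suc nc_var_def mult_single alternating_sum_insert)
  qed
  ultimately show ?thesis
    unfolding ab_poly_def sum_distrib_right by simp
qed

lemma ab_poly_cong:
  assumes "\<And>T. T \<subseteq> {1..n} \<Longrightarrow> f T = g T"
  shows "ab_poly n f = ab_poly n g"
proof -
  have "alternating_sum f S = alternating_sum g S" if "S \<subseteq> {1..n}" for S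
    unfolding alternating_sum_def using assms that by (intro sum.cong) auto
  then show ?thesis unfolding ab_poly_def by (intro sum.cong) auto
qed

lemma ab_poly_add: "ab_poly n (\<lambda>T. f T + g T) = ab_poly n f + ab_poly n g"
  unfolding ab_poly_def alternating_sum_def
  by (simp add: distrib_left sum.distrib single_add)

lemma ab_poly_of_nat: "ab_poly n (\<lambda>T. int k * f T) = of_nat k * ab_poly n f"
proof (induction k)
  case 0
  then show ?case by (simp add: ab_poly_def alternating_sum_def)
next
  case (Suc k)
  have "(\<lambda>T. int (Suc k) * f T) = (\<lambda>T. f T + int k * f T)" by (simp add: algebra_simps)
  then show ?case using Suc by (simp add: ab_poly_add algebra_simps)
qed

text \<open>Write x, y, z for the degree n polynomials of \<open>f T\<close>, of
  \<open>f (insert (Suc n) T) - f T\<close> and of \<open>int k * g T\<close>. The endings aa, ba,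
  ab, bb are preceded by x, y + z, x + z, y respectively, and x aa + (y + z) ba + (x + z) ab + y bb
  equals (x a + y b)(a + b) + z (ab + ba).\<close>

lemma ab_poly_thickening:
  assumes "\<And>T. T \<subseteq> {1..n} \<Longrightarrow> F T = f T"
    and "\<And>T. T \<subseteq> {1..n} \<Longrightarrow> F (insert (Suc n) T) = f (insert (Suc n) T) + int k * g T"
    and "\<And>T. T \<subseteq> {1..n} \<Longrightarrow> F (insert (Suc (Suc n)) T) = 2 * f T + int k * g T"
    and "\<And>T. T \<subseteq> {1..n} \<Longrightarrow>
           F (insert (Suc (Suc n)) (insert (Suc n) T)) = 2 * F (insert (Suc n) T)"
  shows "ab_poly (Suc (Suc n)) F =
           ab_poly (Suc n) f * cd_to_ab LC + of_nat k * ab_poly n g * cd_to_ab LD"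
proof -
  let ?D = "\<lambda>T. f (insert (Suc n) T) - f T"
  let ?F' = "\<lambda>T. F (insert (Suc (Suc n)) T) - F T"
  define D where "D = ab_poly n ?D"
  have "ab_poly n F = ab_poly n f" using assms(1) by (rule ab_poly_cong)
  moreover have "ab_poly n (\<lambda>T. F (insert (Suc n) T) - F T) = D + of_nat k * ab_poly n g"
    unfolding D_def ab_poly_of_nat[symmetric] ab_poly_add[symmetric]
    using assms(1,2) by (intro ab_poly_cong) simp
  moreover have "ab_poly n ?F' = ab_poly n f + of_nat k * ab_poly n g"
    unfolding ab_poly_of_nat[symmetric] ab_poly_add[symmetric]
    using assms(1,3) by (intro ab_poly_cong) simp
  moreover have "ab_poly n (\<lambda>T. ?F' (insert (Suc n) T) - ?F' T) = D"
    unfolding D_def using assms by (intro ab_poly_cong) simp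
  ultimately show ?thesis
    unfolding ab_poly_Suc[of "Suc n"] ab_poly_Suc[of n] D_def[symmetric]
    by (simp only: cd_to_ab.simps algebra_simps)
qed

section \<open>Ranked posets and flag counts\<close>

text \<open>Relative to a vertex set and a given rank function, so that flags in the boundary of a
  cell are counted inside the ambient relation.\<close>

definition flag_count :: "'a rel \<Rightarrow> ('a \<Rightarrow> nat) \<Rightarrow> 'a set \<Rightarrow> nat set \<Rightarrow> nat" where
  "flag_count r \<rho> X U = card {C \<in> chains_in r X. \<rho> ` C = U}"

text \<open>Only the elements with rank in \<open>U\<close> can occur in a chain that is counted, so
  the two posets need to agree there only.\<close>

lemma flag_count_cong:
  assumes "{x \<in> X. \<rho> x \<in> U} = {x \<in> Y. \<rho>' x \<in> U}"
    and "\<And>x. x \<in> X \<Longrightarrow> \<rho> x \<in> U \<Longrightarrow> \<rho>' x = \<rho> x"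
    and "\<And>x y. x \<in> X \<Longrightarrow> y \<in> X \<Longrightarrow> \<rho> x \<in> U \<Longrightarrow> \<rho> y \<in> U \<Longrightarrow> (x, y) \<in> r \<longleftrightarrow> (x, y) \<in> r'"
  shows "flag_count r \<rho> X U = flag_count r' \<rho>' Y U"
proof -
  let ?Z = "{x \<in> X. \<rho> x \<in> U}"
  have Z: "C \<subseteq> ?Z" if "C \<in> chains_in r X" "\<rho> ` C = U" for C
    using that unfolding chains_in_def by blast
  have Z': "C \<subseteq> ?Z" if "C \<in> chains_in r' Y" "\<rho>' ` C = U" for C
    using that unfolding assms(1) chains_in_def by blast
  have "C \<in> chains_in r X \<and> \<rho> ` C = U \<longleftrightarrow> C \<in> chains_in r' Y \<and> \<rho>' ` C = U" if C: "C \<subseteq> ?Z" for C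
  proof -
    have "C \<subseteq> X" "C \<subseteq> Y" using C assms(1) by blast+
    moreover have "C \<in> Chains r \<longleftrightarrow> C \<in> Chains r'"
    proof -
      have "(x, y) \<in> r \<longleftrightarrow> (x, y) \<in> r'" if "x \<in> C" "y \<in> C" for x y
        using that C by (intro assms(3)) auto
      then show ?thesis unfolding Chains_def by blast
    qed
    moreover have "\<rho> ` C = \<rho>' ` C" using C assms(2) by (intro image_cong) auto
    ultimately show ?thesis unfolding chains_in_def by simp
  qed
  then have "C \<in> chains_in r X \<and> \<rho> ` C = U \<longleftrightarrow> C \<in> chains_in r' Y \<and> \<rho>' ` C = U" for C
    using Z[of C] Z'[of C] by metis
  then have "{C \<in> chains_in r X. \<rho> ` C = U} = {C \<in> chains_in r' Y. \<rho>' ` C = U}" by simp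
  then show ?thesis unfolding flag_count_def by simp
qed

text \<open>An explicit rank function stands in for the maxima in \<open>elem_rank\<close> and
  \<open>poset_rank\<close>: strict growth bounds the length of chains, and \<open>rank_pred\<close>
  builds chains that attain the bound.\<close>

locale ranked_poset =
  fixes r :: "'a rel" and \<rho> :: "'a \<Rightarrow> nat" and n :: nat
  assumes poset: "finite_poset_bot r"
    and rank_le: "x \<in> Field r \<Longrightarrow> \<rho> x \<le> n"
    and rank_attained: "\<exists>x \<in> Field r. \<rho> x = n"
    and rank_eq_0_iff: "x \<in> Field r \<Longrightarrow> \<rho> x = 0 \<longleftrightarrow> x = bottom r"
    and rank_less: "(x, y) \<in> r \<Longrightarrow> x \<noteq> y \<Longrightarrow> \<rho> x < \<rho> y"
    and rank_pred: "x \<in> Field r \<Longrightarrow> \<rho> x = Suc m \<Longrightarrow> \<exists>y. (y, x) \<in> r \<and> \<rho> y = m"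

sublocale ranked_poset \<subseteq> finite_order
  using poset by unfold_locales (auto simp: finite_poset_bot_def)

lemma bottom_eqI:
  assumes "finite_poset_bot r" "is_bottom r z"
  shows "bottom r = z"
  unfolding bottom_def
proof (rule the_equality[where a = z])
  fix y assume "is_bottom r y"
  then show "y = z"
    using assms unfolding is_bottom_def finite_poset_bot_def partial_order_on_def
    by (auto dest: antisymD)
qed (use assms in blast)

lemma is_bottom_bottom: "finite_poset_bot r \<Longrightarrow> is_bottom r (bottom r)"
  using bottom_eqI unfolding finite_poset_bot_def by metis

context ranked_poset
begin

abbreviation "elements \<equiv> Field r - {bottom r}"

lemma bottom_in: "bottom r \<in> Field r" and bottom_le: "x \<in> Field r \<Longrightarrow> (bottom r, x) \<in> r"
  using is_bottom_bottom[OF poset] unfolding is_bottom_def by auto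

lemma rank_mono: "(x, y) \<in> r \<Longrightarrow> \<rho> x \<le> \<rho> y"
  using rank_less by (cases "x = y") (auto intro: less_imp_le)

lemma rank_inj_on_chain:
  assumes "C \<in> chains_in r X"
  shows "inj_on \<rho> C"
proof (rule inj_onI, rule ccontr)
  fix x y assume "x \<in> C" "y \<in> C" "\<rho> x = \<rho> y" "x \<noteq> y"
  moreover from this have "(x, y) \<in> r \<or> (y, x) \<in> r"
    using assms unfolding chains_in_def Chains_def by blast
  ultimately show False using rank_less by fastforce
qed

lemma maximal_chain_below:
  "x \<in> Field r \<Longrightarrow> \<rho> x = m \<Longrightarrow>
     \<exists>C \<in> chains_in r elements. card C = m \<and> (\<forall>y \<in> C. (y, x) \<in> r) \<and> (m \<noteq> 0 \<longrightarrow> x \<in> C)"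
proof (induction m arbitrary: x)
  case 0
  then show ?case unfolding chains_in_def Chains_def by (intro bexI[of _ "{}"]) auto
next
  case (Suc m)
  then obtain y where y: "(y, x) \<in> r" "\<rho> y = m" using rank_pred by blast
  then have "y \<in> Field r" by (auto simp: Field_def)
  then obtain C where C: "C \<in> chains_in r elements" "card C = m" "\<forall>z \<in> C. (z, y) \<in> r"
    using Suc.IH y(2) by blast
  have "(z, x) \<in> r" if "z \<in> C" for z using C(3) y(1) that trans by blast
  moreover have "x \<notin> C" using C(3) y(2) Suc.prems(2) rank_mono by fastforce
  moreover have "x \<noteq> bottom r" using Suc.prems rank_eq_0_iff[of x] by auto
  moreover have "finite C" using C(1) by (rule finite_chain)
  ultimately show ?case
    using C Suc.prems refl[of x] unfolding chains_in_def Chains_def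
    by (intro bexI[of _ "insert x C"]) auto
qed

lemma card_chain_le:
  assumes "C \<in> chains_in r elements" "\<And>y. y \<in> C \<Longrightarrow> \<rho> y \<le> m"
  shows "card C \<le> m"
proof -
  have "\<rho> ` C \<subseteq> {1..m}"
    using assms rank_eq_0_iff unfolding chains_in_def by (fastforce simp: Suc_le_eq)
  then have "card (\<rho> ` C) \<le> m" using card_mono[of "{1..m}" "\<rho> ` C"] by simp
  then show ?thesis using card_image[OF rank_inj_on_chain[OF assms(1)]] by simp
qed

lemma finite_order_complex: "finite (order_complex r)"
  using finite_Field finite_subset[of "order_complex r" "Pow (Field r)"]
  by (auto simp: order_complex_eq chains_in_def)

lemma elem_rank_eq:
  assumes "x \<in> elements"
  shows "elem_rank r x = \<rho> x"
  unfolding elem_rank_def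
proof (rule Max_eqI)
  show "finite (card ` {C \<in> order_complex r. x \<in> C \<and> (\<forall>y \<in> C. (y, x) \<in> r)})"
    using finite_order_complex by simp
  show "c \<le> \<rho> x" if "c \<in> card ` {C \<in> order_complex r. x \<in> C \<and> (\<forall>y \<in> C. (y, x) \<in> r)}" for c
    using that card_chain_le rank_mono unfolding order_complex_eq by auto
  have "\<rho> x \<noteq> 0" using assms rank_eq_0_iff by auto
  then show "\<rho> x \<in> card ` {C \<in> order_complex r. x \<in> C \<and> (\<forall>y \<in> C. (y, x) \<in> r)}"
    using maximal_chain_below[of x "\<rho> x"] assms unfolding order_complex_eq by force
qed

lemma poset_rank_eq: "poset_rank r = n"
  unfolding poset_rank_def
proof (rule Max_eqI)
  show "finite (card ` order_complex r)" using finite_order_complex by simp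
  show "c \<le> n" if "c \<in> card ` order_complex r" for c
    using that card_chain_le rank_le unfolding order_complex_eq chains_in_def by blast
  show "n \<in> card ` order_complex r"
    using rank_attained maximal_chain_below unfolding order_complex_eq by force
qed

lemma flag_f_eq: "flag_f r U = flag_count r \<rho> elements U"
proof -
  have "elem_rank r ` C = \<rho> ` C" if "C \<in> chains_in r elements" for C
    using that elem_rank_eq unfolding chains_in_def by (intro image_cong) auto
  then show ?thesis unfolding flag_f_def flag_count_def order_complex_eq by (metis (no_types, lifting))
qed

lemma ab_index_eq_flag_count: "ab_index r = ab_poly n (\<lambda>U. int (flag_count r \<rho> elements U))"
  unfolding ab_index_eq poset_rank_eq flag_f_eq ..

text \<open>The rank \<open>m\<close> exceeds all of \<open>U\<close>, so the element of rank
  \<open>m\<close> is the top of its chain; removing it gives a chain in the strict down-set of that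
  element.\<close>

lemma flag_count_insert:
  assumes X: "X \<subseteq> Field r" and U: "U \<subseteq> {..<m}"
  shows "flag_count r \<rho> X (insert m U) = (\<Sum>x | x \<in> X \<and> \<rho> x = m. flag_count r \<rho> (X \<inter> underS r x) U)"
proof -
  let ?S = "\<lambda>x. {C \<in> chains_in r (X \<inter> underS r x). \<rho> ` C = U}"
  let ?T = "{C \<in> chains_in r X. \<rho> ` C = insert m U}"
  let ?I = "SIGMA x : {x \<in> X. \<rho> x = m}. ?S x"
  have "finite X" using X finite_Field by (rule finite_subset)
  have "bij_betw (\<lambda>(x, C). insert x C) ?I ?T"
    unfolding bij_betw_def
  proof (intro conjI inj_onI equalityI subsetI)
    fix p q
    assume pq: "p \<in> ?I" "q \<in> ?I" "(\<lambda>(x, C). insert x C) p = (\<lambda>(x, C). insert x C) q"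
    obtain x C y D where xy: "p = (x, C)" "q = (y, D)" by (cases p; cases q)
    have "\<rho> ` C = U" "\<rho> ` D = U" "m \<notin> U" using pq U unfolding xy by auto
    then have "\<rho> z \<noteq> m" if "z \<in> C \<union> D" for z using that by blast
    moreover have "\<rho> x = m" "\<rho> y = m" "insert x C = insert y D" using pq unfolding xy by auto
    ultimately have "x = y \<and> C = D" by (metis UnCI insertI1 insert_iff insert_ident)
    then show "p = q" using xy by simp
  next
    fix C assume "C \<in> (\<lambda>(x, C). insert x C) ` ?I"
    then obtain x D where D: "C = insert x D" "x \<in> X" "\<rho> x = m" "D \<in> ?S x" by auto
    then have "(x, x) \<in> r" using X refl by blast
    then show "C \<in> ?T" using D unfolding chains_in_def Chains_def underS_def by auto
  next
    fix C assume C: "C \<in> ?T"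
    then have "m \<in> \<rho> ` C" by simp
    then obtain x where x: "x \<in> C" "\<rho> x = m" by auto
    have other: "\<rho> y \<in> U \<and> (y, x) \<in> r" if y: "y \<in> C" "y \<noteq> x" for y
    proof -
      have "\<rho> y \<noteq> m" using C rank_inj_on_chain[of C X] x y unfolding inj_on_def by auto
      then have "\<rho> y \<in> U" using C y by blast
      then have "\<not> \<rho> x \<le> \<rho> y" using U x by auto
      moreover have "(x, y) \<in> r \<or> (y, x) \<in> r"
        using C x y unfolding chains_in_def Chains_def by blast
      ultimately show ?thesis using rank_mono \<open>\<rho> y \<in> U\<close> by blast
    qed
    have "\<rho> ` (C - {x}) = U"
    proof
      show "\<rho> ` (C - {x}) \<subseteq> U" using other by blast
      have "U \<subseteq> \<rho> ` C" "m \<notin> U" using C U by auto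
      then show "U \<subseteq> \<rho> ` (C - {x})" using x by blast
    qed
    moreover have "C - {x} \<in> chains_in r (X \<inter> underS r x)"
      using C other unfolding chains_in_def Chains_def underS_def by auto
    ultimately have "(x, C - {x}) \<in> ?I" using C x unfolding chains_in_def by auto
    moreover have "C = (\<lambda>(x, C). insert x C) (x, C - {x})" using x by auto
    ultimately show "C \<in> (\<lambda>(x, C). insert x C) ` ?I" by (rule rev_image_eqI)
  qed
  then have "card ?T = card ?I" by (simp add: bij_betw_same_card)
  also have "\<dots> = (\<Sum>x | x \<in> X \<and> \<rho> x = m. card (?S x))"
  proof (rule card_SigmaI)
    show "\<forall>x \<in> {x \<in> X. \<rho> x = m}. finite (?S x)"
    proof
      fix x
      have "?S x \<subseteq> Pow X" by (auto simp: chains_in_def)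
      then show "finite (?S x)" using \<open>finite X\<close> finite_subset by auto
    qed
  qed (use \<open>finite X\<close> in simp)
  finally show ?thesis unfolding flag_count_def .
qed

lemma Field_boundary_poset:
  assumes "x \<in> Field r"
  shows "Field (boundary_poset r x) = underS r x"
proof -
  have "(y, y) \<in> boundary_poset r x" if "y \<in> underS r x" for y
  proof -
    have "y \<in> Field r" using that by (auto simp: underS_def Field_def)
    then show ?thesis using that refl by (auto simp: boundary_poset_def)
  qed
  then show ?thesis unfolding Field_def boundary_poset_def by blast
qed

lemma boundary_poset_ranked:
  assumes x: "x \<in> Field r" "\<rho> x = Suc m"
  shows "ranked_poset (boundary_poset r x) \<rho> m" "bottom (boundary_poset r x) = bottom r"
proof -
  let ?b = "boundary_poset r x"
  note F = Field_boundary_poset[OF x(1)]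
  have sub: "underS r x \<subseteq> Field r" by (auto simp: underS_def Field_def)
  have "bottom r \<noteq> x" using x rank_eq_0_iff[of x] by auto
  then have bot: "is_bottom ?b (bottom r)"
    using bottom_le[OF x(1)] bottom_le sub unfolding is_bottom_def F unfolding boundary_poset_def underS_def by auto
  have "Partial_order ?b"
    using Partial_order_Restr[OF partial_order] unfolding boundary_poset_def .
  then have P: "finite_poset_bot ?b"
    using bot sub finite_Field unfolding finite_poset_bot_def F by (auto intro: finite_subset)
  then show b: "bottom ?b = bottom r" using bot by (rule bottom_eqI)
  show "ranked_poset ?b \<rho> m"
  proof
    show "finite_poset_bot ?b" by (rule P)
    show "\<rho> y \<le> m" if "y \<in> Field ?b" for y
      using that rank_less[of y x] x(2) unfolding F by (auto simp: underS_def)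
    obtain y where y: "(y, x) \<in> r" "\<rho> y = m" using rank_pred x by blast
    then have "y \<noteq> x" using x by auto
    then show "\<exists>y \<in> Field ?b. \<rho> y = m" using y unfolding F by (auto simp: underS_def)
    show "\<rho> y = 0 \<longleftrightarrow> y = bottom ?b" if "y \<in> Field ?b" for y
      using that sub rank_eq_0_iff[of y] unfolding F b by auto
    show "\<rho> y < \<rho> z" if "(y, z) \<in> ?b" "y \<noteq> z" for y z
      using that rank_less unfolding boundary_poset_def by blast
    show "\<exists>z. (z, y) \<in> ?b \<and> \<rho> z = l" if y: "y \<in> Field ?b" "\<rho> y = Suc l" for y l
    proof -
      have yx: "(y, x) \<in> r" "y \<noteq> x" using y unfolding F by (auto simp: underS_def)
      obtain z where z: "(z, y) \<in> r" "\<rho> z = l" using y sub rank_pred unfolding F by blast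
      have "(z, x) \<in> r" using z yx trans by blast
      moreover have "z \<noteq> x" using rank_less[OF yx] y z by auto
      ultimately show ?thesis using z yx unfolding boundary_poset_def underS_def by auto
    qed
  qed
qed

end

section \<open>Adding maximal elements\<close>

definition add_maximal :: "'a rel \<Rightarrow> nat set \<Rightarrow> (nat \<Rightarrow> 'a) \<Rightarrow> (nat \<Rightarrow> 'a set) \<Rightarrow> 'a rel" where
  "add_maximal r I t D = r \<union> {(x, y). \<exists>j \<in> I. y = t j \<and> (x = y \<or> x \<in> D j)}"

text \<open>The rank of the result is left open through \<open>n'\<close>: parallel facets keep it,
  even for empty \<open>I\<close>, while cells over a whole sphere raise it. \<open>D_top\<close>
  provides the new elements with a predecessor of rank \<open>N\<close>.\<close>

lemma (in ranked_poset) add_maximal_ranked: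
  fixes I t D and N n' :: nat
  defines "q \<equiv> add_maximal r I t D"
  defines "\<rho>' \<equiv> (\<lambda>x. if x \<in> t ` I then Suc N else \<rho> x)"
  assumes fin: "finite I"
    and fresh: "\<And>j. j \<in> I \<Longrightarrow> t j \<notin> Field r"
    and D_sub: "\<And>j. j \<in> I \<Longrightarrow> D j \<subseteq> Field r"
    and D_down: "\<And>j x y. j \<in> I \<Longrightarrow> y \<in> D j \<Longrightarrow> (x, y) \<in> r \<Longrightarrow> x \<in> D j"
    and D_rank: "\<And>j x. j \<in> I \<Longrightarrow> x \<in> D j \<Longrightarrow> \<rho> x \<le> N"
    and D_top: "\<And>j. j \<in> I \<Longrightarrow> \<exists>x \<in> D j. \<rho> x = N"
    and n': "n \<le> n'" "Suc N \<le> n'" "n' = n \<or> I \<noteq> {} \<and> n' = Suc N"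
  shows "ranked_poset q \<rho>' n'" "Field q = Field r \<union> t ` I" "bottom q = bottom r"
proof -
  show F: "Field q = Field r \<union> t ` I"
    unfolding q_def add_maximal_def Field_def using D_sub by (fastforce simp: Field_def)
  have q: "(x, y) \<in> q \<longleftrightarrow> (x, y) \<in> r \<or> (\<exists>j \<in> I. y = t j \<and> (x = y \<or> x \<in> D j))" for x y
    unfolding q_def add_maximal_def by blast
  have r_Field: "x \<in> Field r" "y \<in> Field r" if "(x, y) \<in> r" for x y
    using that by (auto simp: Field_def)
  have rank_old: "\<rho>' x = \<rho> x" if "x \<in> Field r" for x
    using that fresh unfolding \<rho>'_def by auto
  have rank_new: "\<rho>' (t j) = Suc N" if "j \<in> I" for j
    using that unfolding \<rho>'_def by auto
  have less: "\<rho>' x < \<rho>' y" if xy: "(x, y) \<in> q" "x \<noteq> y" for x y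
  proof (cases "(x, y) \<in> r")
    case True
    then show ?thesis using rank_less xy(2) rank_old r_Field by metis
  next
    case False
    then obtain j where j: "j \<in> I" "y = t j" "x \<in> D j" using xy q by blast
    then show ?thesis using D_rank[of j x] D_sub rank_old rank_new by force
  qed
  have "refl_on (Field q) q" unfolding F refl_on_def using q refl by blast
  moreover have "trans q"
  proof (rule transI)
    fix x y z assume xy: "(x, y) \<in> q" "(y, z) \<in> q"
    show "(x, z) \<in> q"
    proof (cases "(y, z) \<in> r")
      case True
      then have "(x, y) \<in> r" using xy(1) q fresh r_Field by blast
      then show ?thesis using True trans q by blast
    next
      case False
      then obtain j where j: "j \<in> I" "z = t j" "y = z \<or> y \<in> D j" using xy q by blast
      show ?thesis
      proof (cases "y = z")
        case True
        then show ?thesis using xy by simp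
      next
        case False
        then have "y \<in> D j" using j by blast
        moreover from this have "(x, y) \<in> r" using xy(1) q fresh D_sub j(1) by blast
        ultimately show ?thesis using D_down j q by blast
      qed
    qed
  qed
  \<comment> \<open>Two distinct elements below each other would each have the smaller rank.\<close>
  moreover have "antisym q"
    by (rule antisymI) (metis less less_asym)
  ultimately have po: "Partial_order q"
    by (auto simp: partial_order_on_def preorder_on_def refl_on_def Field_def)
  have "bottom r \<in> D j" if "j \<in> I" for j
    using D_top[OF that] D_sub[OF that] D_down[OF that] bottom_le by blast
  then have bot: "is_bottom q (bottom r)"
    unfolding is_bottom_def F using bottom_in bottom_le q by blast
  have P: "finite_poset_bot q"
    unfolding finite_poset_bot_def using po bot F finite_Field fin by auto
  then show b: "bottom q = bottom r" using bot by (rule bottom_eqI)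
  show "ranked_poset q \<rho>' n'"
  proof
    show "finite_poset_bot q" by (rule P)
    show "\<rho>' x \<le> n'" if "x \<in> Field q" for x
      using that n' rank_le rank_old rank_new unfolding F by fastforce
    show "\<exists>x \<in> Field q. \<rho>' x = n'"
      using n'(3) rank_attained rank_old rank_new unfolding F by fastforce
    show "\<rho>' x = 0 \<longleftrightarrow> x = bottom q" if "x \<in> Field q" for x
      using that rank_eq_0_iff rank_old rank_new fresh bottom_in unfolding F b by fastforce
    show "\<rho>' x < \<rho>' y" if "(x, y) \<in> q" "x \<noteq> y" for x y
      using that by (rule less)
    show "\<exists>y. (y, x) \<in> q \<and> \<rho>' y = m" if x: "x \<in> Field q" "\<rho>' x = Suc m" for x m
    proof (cases "x \<in> Field r")
      case True
      then obtain y where "(y, x) \<in> r" "\<rho> y = m" using rank_pred x rank_old by metis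
      then show ?thesis using q rank_old r_Field by blast
    next
      case False
      then obtain j where j: "j \<in> I" "x = t j" using x F by blast
      then have "m = N" using x rank_new by auto
      moreover obtain y where "y \<in> D j" "\<rho> y = N" using D_top j by blast
      ultimately show ?thesis using q j rank_old D_sub by blast
    qed
  qed
qed

section \<open>Thickening a facet\<close>

text \<open>The poset has rank n+1, so the boundary of the facet \<open>s 0\<close> has rank n and
  the thickened poset has rank n+2.\<close>

locale thick_poset = ranked_poset r \<rho> "Suc n" for r :: "'a rel" and \<rho> n +
  fixes k :: nat and s t :: "nat \<Rightarrow> 'a"
  assumes s0: "s 0 \<in> Field r" "\<rho> (s 0) = Suc n"
    and s_fresh: "j \<in> {1..k} \<Longrightarrow> s j \<notin> Field r"
    and t_fresh: "j \<le> Suc k \<Longrightarrow> t j \<notin> Field r"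
    and s_inj: "inj_on s {..k}" and t_inj: "inj_on t {..Suc k}"
    and s_neq_t: "i \<le> k \<Longrightarrow> j \<le> Suc k \<Longrightarrow> s i \<noteq> t j"
begin

text \<open>The layers come before the cells because \<open>add_maximal\<close> adds an antichain,
  and the cell boundaries already contain the layers.\<close>

definition layered :: "'a rel" where
  "layered = add_maximal r {1..k} s (\<lambda>_. underS r (s 0))"

text \<open>Strict down-sets, hence including the bottom element. For \<open>k = 0\<close> there are
  no lenses and both outer cells have the whole of \<open>r\<close> as boundary.\<close>

definition cell_boundary :: "nat \<Rightarrow> 'a set" where
  "cell_boundary j =
     (if j = 0 then Field r
      else if j = Suc k then insert (s k) (Field r - {s 0})
      else underS r (s 0) \<union> {s (j - 1), s j})"

definition thickened :: "'a rel" where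
  "thickened = add_maximal layered {..Suc k} t cell_boundary"

definition layered_rank :: "'a \<Rightarrow> nat" where
  "layered_rank x = (if x \<in> s ` {1..k} then Suc n else \<rho> x)"

definition thickened_rank :: "'a \<Rightarrow> nat" where
  "thickened_rank x = (if x \<in> t ` {..Suc k} then Suc (Suc n) else layered_rank x)"

lemma r_Field: "(x, y) \<in> r \<Longrightarrow> x \<in> Field r \<and> y \<in> Field r"
  by (auto simp: Field_def)

lemma underS_subset: "underS r x \<subseteq> Field r"
  by (auto simp: underS_def Field_def)

lemma s_eq_iff: "i \<le> k \<Longrightarrow> j \<le> k \<Longrightarrow> s i = s j \<longleftrightarrow> i = j"
  using s_inj by (auto simp: inj_on_def)

lemma t_eq_iff: "i \<le> Suc k \<Longrightarrow> j \<le> Suc k \<Longrightarrow> t i = t j \<longleftrightarrow> i = j"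
  using t_inj by (auto simp: inj_on_def)

lemma s_in_Field_iff: "j \<le> k \<Longrightarrow> s j \<in> Field r \<longleftrightarrow> j = 0"
  using s0 s_fresh[of j] by (cases j) auto

lemma s0_maximal: "(s 0, x) \<in> r \<Longrightarrow> x = s 0"
  using rank_less[of "s 0" x] rank_le[of x] s0 r_Field by fastforce

lemma s0_not_underS: "s 0 \<notin> underS r x"
  using s0_maximal unfolding underS_def by blast

lemma s_neq_bottom: "j \<le> k \<Longrightarrow> s j \<noteq> bottom r"
  using s_in_Field_iff[of j] s0 rank_eq_0_iff[of "s 0"] bottom_in by (metis nat.distinct(1))

lemma t_neq_bottom: "j \<le> Suc k \<Longrightarrow> t j \<noteq> bottom r"
  using t_fresh bottom_in by metis

lemma layered_ranked:
  "ranked_poset layered layered_rank (Suc n)"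
  "Field layered = Field r \<union> s ` {1..k}"
  "bottom layered = bottom r"
proof -
  have down: "x \<in> underS r (s 0)" if "y \<in> underS r (s 0)" "(x, y) \<in> r" for x y
    using that trans s0_not_underS antisym unfolding underS_def by blast
  have rank: "\<rho> x \<le> n" if "x \<in> underS r (s 0)" for x
    using that rank_less[of x "s 0"] s0 unfolding underS_def by auto
  have top: "\<exists>x \<in> underS r (s 0). \<rho> x = n"
    using rank_pred[OF s0] s0(2) unfolding underS_def by fastforce
  note * = add_maximal_ranked[of "{1..k}" s "\<lambda>_. underS r (s 0)" n "Suc n",
      OF _ _ underS_subset down rank top]
  show "ranked_poset layered layered_rank (Suc n)"
    unfolding layered_def layered_rank_def[abs_def] by (rule *) (use s_fresh in auto)
  show "Field layered = Field r \<union> s ` {1..k}"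
    unfolding layered_def by (rule *) (use s_fresh in auto)
  show "bottom layered = bottom r"
    unfolding layered_def by (rule *) (use s_fresh in auto)
qed

lemma layered_iff:
  "(x, y) \<in> layered \<longleftrightarrow> (x, y) \<in> r \<or> (\<exists>j \<in> {1..k}. y = s j \<and> (x = y \<or> x \<in> underS r (s 0)))"
  unfolding layered_def add_maximal_def by blast

lemma layered_rank_old: "x \<in> Field r \<Longrightarrow> layered_rank x = \<rho> x"
  using s_fresh unfolding layered_rank_def by auto

lemma layered_rank_s: "j \<le> k \<Longrightarrow> layered_rank (s j) = Suc n"
  using s0 layered_rank_old[of "s 0"] unfolding layered_rank_def by (cases j) auto

lemma cell_boundary_subset: "j \<le> Suc k \<Longrightarrow> cell_boundary j \<subseteq> Field layered"
  using underS_subset[of "s 0"] s0 layered_ranked(2)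
  unfolding cell_boundary_def by (auto simp: image_iff Suc_le_eq) (metis One_nat_def Suc_leI atLeastAtMost_iff le_Suc_eq le_trans not_gr_zero nat_le_linear diff_le_self)+

lemma underS_subset_cell_boundary: "underS r (s 0) \<subseteq> cell_boundary j"
  using underS_subset[of "s 0"] s0_not_underS unfolding cell_boundary_def by auto

lemma s_in_cell_boundary_iff:
  assumes "i \<le> k" "j \<le> Suc k"
  shows "s i \<in> cell_boundary j \<longleftrightarrow> j = i \<or> j = Suc i"
proof -
  have "s i \<notin> underS r (s 0)"
    using underS_subset s0_not_underS s_in_Field_iff[OF assms(1)] by blast
  then show ?thesis
    using assms s_in_Field_iff[OF assms(1)] s_eq_iff[of i] unfolding cell_boundary_def by auto
qed

lemma thickened_ranked:
  "ranked_poset thickened thickened_rank (Suc (Suc n))"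
  "Field thickened = Field r \<union> s ` {1..k} \<union> t ` {..Suc k}"
  "bottom thickened = bottom r"
proof -
  interpret L: ranked_poset layered layered_rank "Suc n" by (rule layered_ranked)
  have fresh: "t j \<notin> Field layered" if "j \<in> {..Suc k}" for j
    using that t_fresh[of j] s_neq_t[of _ j] unfolding layered_ranked(2) by fastforce
  have down: "x \<in> cell_boundary j"
    if "j \<in> {..Suc k}" "y \<in> cell_boundary j" "(x, y) \<in> layered" for j x y
  proof (cases "(x, y) \<in> r \<and> x \<noteq> y")
    case True
    then have "x \<in> underS r (s 0)" if "y \<in> underS r (s 0)"
      using that trans s0_not_underS antisym unfolding underS_def by blast
    moreover have "x \<noteq> s 0" using True s0_maximal by blast
    moreover have "y \<noteq> s i" if "i \<in> {1..k}" for i using True r_Field s_fresh that by blast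
    moreover have "x \<in> Field r" using True r_Field by blast
    moreover have "x \<in> underS r (s 0)" if "y = s 0" using that True unfolding underS_def by blast
    ultimately show ?thesis
      using \<open>y \<in> cell_boundary j\<close> \<open>j \<in> {..Suc k}\<close> unfolding cell_boundary_def
      by (auto split: if_splits) (metis One_nat_def Suc_leI atLeastAtMost_iff le_Suc_eq le_trans not_gr_zero nat_le_linear diff_le_self)+
  next
    case False
    then have "x = y \<or> x \<in> underS r (s 0)" using that(3) layered_iff by blast
    then show ?thesis using that(2) underS_subset_cell_boundary by blast
  qed
  have top: "\<exists>x \<in> cell_boundary j. layered_rank x = Suc n" if "j \<in> {..Suc k}" for j
  proof (cases "j = Suc k")
    case True
    then show ?thesis using s_in_cell_boundary_iff[of k j] layered_rank_s[of k] by auto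
  next
    case False
    then show ?thesis using that s_in_cell_boundary_iff[of j j] layered_rank_s[of j] by auto
  qed
  have rank: "layered_rank x \<le> Suc n" if "j \<in> {..Suc k}" "x \<in> cell_boundary j" for j x
    using that cell_boundary_subset L.rank_le by blast
  have sub: "cell_boundary j \<subseteq> Field layered" if "j \<in> {..Suc k}" for j
    using that cell_boundary_subset by simp
  note * = L.add_maximal_ranked[of "{..Suc k}" t cell_boundary "Suc n" "Suc (Suc n)",
      OF _ fresh sub down rank top]
  show "ranked_poset thickened thickened_rank (Suc (Suc n))"
    unfolding thickened_def thickened_rank_def[abs_def] by (rule *) auto
  show "Field thickened = Field r \<union> s ` {1..k} \<union> t ` {..Suc k}"
    unfolding thickened_def layered_ranked(2)[symmetric] by (rule *) auto
  show "bottom thickened = bottom r"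
    unfolding thickened_def layered_ranked(3)[symmetric] by (rule *) auto
qed

lemma thickened_iff:
  "(x, y) \<in> thickened \<longleftrightarrow> (x, y) \<in> layered \<or>
     (\<exists>j \<le> Suc k. y = t j \<and> (x = y \<or> x \<in> cell_boundary j))"
  unfolding thickened_def add_maximal_def by blast

text \<open>The strict down-sets of old elements, layers and cells, computed here and in the next
  two lemmas, decide comparability in the new poset and are also the sets over which its flags are
  counted.\<close>

lemma underS_old: "x \<in> Field r \<Longrightarrow> underS thickened x = underS r x"
  using s_fresh t_fresh unfolding underS_def thickened_iff layered_iff by blast

lemma underS_s:
  assumes "j \<le> k"
  shows "underS thickened (s j) = underS r (s 0)"
proof (cases "j = 0")
  case True
  then show ?thesis using underS_old s0 by simp
next
  case False
  then have j: "j \<in> {1..k}" "s j \<notin> Field r" using assms s_fresh by auto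
  then have "(x, s j) \<notin> r" for x using r_Field by blast
  moreover have "s j \<noteq> t i" if "i \<le> Suc k" for i using s_neq_t assms that by blast
  moreover have "s j \<notin> underS r (s 0)" using j underS_subset by blast
  ultimately show ?thesis
    unfolding underS_def[of thickened] thickened_iff layered_iff using j by auto
qed

lemma underS_t:
  assumes "j \<le> Suc k"
  shows "underS thickened (t j) = cell_boundary j"
proof -
  have t: "t j \<notin> Field layered"
    using assms t_fresh[of j] s_neq_t[of _ j] unfolding layered_ranked(2) by fastforce
  then have "(x, t j) \<notin> layered" for x by (auto simp: Field_def)
  moreover have "t j \<notin> cell_boundary j" using t assms cell_boundary_subset by blast
  ultimately show ?thesis
    unfolding underS_def thickened_iff using assms t_eq_iff by auto
qed

lemma comparable_thickened:
  "comparable thickened x y \<longleftrightarrow> x \<in> underS thickened y \<or> y \<in> underS thickened x"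
  unfolding comparable_def underS_def by auto

lemma comparable_old:
  "x \<in> Field r \<Longrightarrow> y \<in> Field r \<Longrightarrow> comparable thickened x y = comparable r x y"
  unfolding comparable_thickened underS_old by (auto simp: comparable_def underS_def)

lemma manifold_thickened:
  assumes "manifold_set (comparable r) (Suc n) (Field r - {bottom r})"
  shows "manifold_set (comparable thickened) (Suc (Suc n)) (Field thickened - {bottom thickened})"
proof -
  let ?E = "comparable thickened" and ?A = "Field r - {bottom r}"
  have s_underS: "s j \<notin> underS r x" if "j \<le> k" for j x
    using that underS_subset s0_not_underS s_in_Field_iff by blast
  have t_underS: "t j \<notin> underS r x" if "j \<le> Suc k" for j x
    using that underS_subset t_fresh by blast
  have t_cell: "t j \<notin> cell_boundary i" if "i \<le> Suc k" "j \<le> Suc k" for i j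
    using that cell_boundary_subset[of i] t_fresh[of j] s_neq_t[of _ j] unfolding layered_ranked(2) by fastforce
  have s0_bot: "s 0 \<noteq> bottom r" using s0 rank_eq_0_iff by fastforce
  interpret T: thickening ?E ?A s t k
  proof
    show "?E y x" if "?E x y" for x y using that by (auto simp: comparable_def)
    show "\<not> ?E x x" for x by (simp add: comparable_def)
    show "s 0 \<in> ?A" using s0 s0_bot by simp
    show "s j \<notin> ?A" if "j \<in> {1..k}" for j using that s_fresh by blast
    show "t j \<notin> ?A" if "j \<le> Suc k" for j using that t_fresh by blast
    show "inj_on s {..k}" "inj_on t {..Suc k}" by (rule s_inj, rule t_inj)
    show "s i \<noteq> t j" if "i \<le> k" "j \<le> Suc k" for i j using that by (rule s_neq_t)
    show "\<not> ?E (s i) (s j)" if "i \<le> k" "j \<le> k" for i j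
      using that by (simp add: comparable_thickened underS_s s_underS)
    show "\<not> ?E (t i) (t j)" if "i \<le> Suc k" "j \<le> Suc k" for i j
      using that by (simp add: comparable_thickened underS_t t_cell)
    show "?E (s i) (t j) \<longleftrightarrow> j = i \<or> j = Suc i" if "i \<le> k" "j \<le> Suc k" for i j
      using that by (simp add: comparable_thickened underS_s underS_t t_underS s_in_cell_boundary_iff)
    show "?E x (s j) \<longleftrightarrow> ?E x (s 0)" if "x \<in> ?A" "j \<le> k" for x j
      using that by (simp add: comparable_thickened underS_s underS_old s_underS)
    show "?E x (t j) \<longleftrightarrow> j = 0 \<or> j = Suc k \<or> ?E x (s 0)" if "x \<in> ?A" "x \<noteq> s 0" "j \<le> Suc k" for x j
    proof -
      have "x \<noteq> s i" if "i \<le> k" for i using that \<open>x \<in> ?A\<close> \<open>x \<noteq> s 0\<close> s_in_Field_iff by auto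
      then show ?thesis
        using that unfolding comparable_thickened
        by (auto simp: underS_s underS_old underS_t t_underS s_underS cell_boundary_def)
    qed
  qed
  have "manifold_set ?E (Suc n) ?A"
    using assms by (rule manifold_set_cong) (simp add: comparable_old)
  then have "manifold_set ?E (Suc (Suc n)) (T.thick ?A)"
    using s0 s0_bot by (intro T.manifold_thick) auto
  moreover have "s ` {..k} = insert (s 0) (s ` {1..k})"
    by (metis One_nat_def atLeast0AtMost atLeastAtMost_insertL image_insert le0)
  then have "T.thick ?A = Field thickened - {bottom thickened}"
    using s0 s0_bot s_fresh t_fresh bottom_in unfolding T.thick_def thickened_ranked by auto
  ultimately show ?thesis by simp
qed

section \<open>Flag counts of the thickened poset\<close>

lemma thickened_rank_old: "x \<in> Field r \<Longrightarrow> thickened_rank x = \<rho> x"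
  using t_fresh layered_rank_old unfolding thickened_rank_def by auto

lemma thickened_rank_s: "j \<le> k \<Longrightarrow> thickened_rank (s j) = Suc n"
  using s_neq_t layered_rank_s unfolding thickened_rank_def by auto

lemma thickened_rank_t: "j \<le> Suc k \<Longrightarrow> thickened_rank (t j) = Suc (Suc n)"
  unfolding thickened_rank_def by auto

abbreviation "facet_boundary \<equiv> underS r (s 0) - {bottom r}"

context
  fixes U :: "nat set"
  assumes U: "U \<subseteq> {1..n}"
begin

text \<open>Applied to rank sets below n+1: the added elements have rank n+1 or n+2 and cannot occur
  in such flags.\<close>

lemma flag_count_old:
  assumes "V \<subseteq> {1..Suc n}" "Y \<subseteq> Field r"
    and "{x \<in> X. thickened_rank x \<in> V} = {x \<in> Y. \<rho> x \<in> V}"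
  shows "flag_count thickened thickened_rank X V = flag_count r \<rho> Y V"
proof (rule flag_count_cong[OF assms(3)])
  have X: "x \<in> Field r" if "x \<in> X" "thickened_rank x \<in> V" for x using that assms(2,3) by blast
  show "\<rho> x = thickened_rank x" if "x \<in> X" "thickened_rank x \<in> V" for x
    using X[OF that] thickened_rank_old by simp
  fix x y assume "x \<in> X" "y \<in> X" "thickened_rank x \<in> V" "thickened_rank y \<in> V"
  then show "(x, y) \<in> thickened \<longleftrightarrow> (x, y) \<in> r"
    using X underS_old[of y] refl unfolding underS_def
    by (metis (mono_tags, lifting) mem_Collect_eq thickened_iff layered_iff)
qed

lemma U_ranks: "Suc n \<notin> U" "Suc (Suc n) \<notin> U" "U \<subseteq> {1..Suc n}" "U \<subseteq> {..<Suc n}"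
    "insert (Suc n) U \<subseteq> {..<Suc (Suc n)}" "U \<subseteq> {..<Suc (Suc n)}"
  using U by auto

lemma flag_count_underS_old:
  assumes "x \<in> Field r"
  shows "flag_count thickened thickened_rank (underS r x - {bottom r}) U =
         flag_count r \<rho> (underS r x - {bottom r}) U"
  using assms underS_subset[of x] thickened_rank_old
  by (intro flag_count_old U_ranks) auto

interpretation Q: ranked_poset thickened thickened_rank "Suc (Suc n)"
  by (rule thickened_ranked)

lemma flag_count_old_facets:
  "flag_count r \<rho> elements (insert (Suc n) U) =
     (\<Sum>x | x \<in> elements \<and> \<rho> x = Suc n. flag_count r \<rho> (underS r x - {bottom r}) U)"
  unfolding flag_count_insert[OF Diff_subset U_ranks(4)]
  using underS_subset by (intro sum.cong arg_cong2[where f = "flag_count r \<rho>"]) auto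

lemma flag_count_Q_insert:
  assumes "X \<subseteq> Q.elements" "\<And>x. x \<in> X \<Longrightarrow> underS thickened x - {bottom r} \<subseteq> X"
    "V \<subseteq> {..<m}"
  shows "flag_count thickened thickened_rank X (insert m V) =
     (\<Sum>x | x \<in> X \<and> thickened_rank x = m.
        flag_count thickened thickened_rank (underS thickened x - {bottom r}) V)"
proof -
  have "X \<inter> underS thickened x = underS thickened x - {bottom r}" if "x \<in> X" for x
    using assms(2)[OF that] assms(1) thickened_ranked(3) by auto
  then show ?thesis
    using assms(1) by (subst Q.flag_count_insert[OF _ assms(3)]) (auto intro!: sum.cong)
qed

lemma underS_Q_subset: "x \<in> Field thickened \<Longrightarrow> underS thickened x - {bottom r} \<subseteq> Q.elements"
  unfolding thickened_ranked(3) underS_def Field_def by blast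

lemma flag_count_thickened_low:
  "flag_count thickened thickened_rank Q.elements U = flag_count r \<rho> elements U"
  using U_ranks thickened_rank_old thickened_rank_s thickened_rank_t
  unfolding thickened_ranked(2,3)
  by (intro flag_count_old) auto

text \<open>The layers \<open>s 1, ..., s k\<close> are k additional elements of rank n+1, each with
  the flags of the common facet boundary beneath it.\<close>

lemma flag_count_thickened_layer:
  "flag_count thickened thickened_rank Q.elements (insert (Suc n) U) =
     flag_count r \<rho> elements (insert (Suc n) U) + k * flag_count r \<rho> facet_boundary U"
proof -
  let ?g = "\<lambda>x. flag_count thickened thickened_rank (underS thickened x - {bottom r}) U"
  have s: "?g (s j) = flag_count r \<rho> facet_boundary U" if "j \<in> {1..k}" for j
    using that flag_count_underS_old[OF s0(1)] by (simp add: underS_s)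
  have old: "?g x = flag_count r \<rho> (underS r x - {bottom r}) U" if "x \<in> Field r" for x
    using that flag_count_underS_old by (simp add: underS_old)
  have "{x. x \<in> Q.elements \<and> thickened_rank x = Suc n} = {x \<in> elements. \<rho> x = Suc n} \<union> s ` {1..k}"
    using thickened_rank_old thickened_rank_s thickened_rank_t s_fresh s_neq_bottom
    unfolding thickened_ranked(2,3) by auto
  moreover have "{x \<in> elements. \<rho> x = Suc n} \<inter> s ` {1..k} = {}" using s_fresh by auto
  moreover have "finite {x \<in> elements. \<rho> x = Suc n}" using finite_Field by simp
  moreover have "inj_on s {1..k}" using s_inj by (rule inj_on_subset) auto
  ultimately have "flag_count thickened thickened_rank Q.elements (insert (Suc n) U) =
      (\<Sum>x | x \<in> elements \<and> \<rho> x = Suc n. ?g x) + (\<Sum>j \<in> {1..k}. ?g (s j))"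
    using underS_Q_subset
    by (subst flag_count_Q_insert[OF order.refl _ U_ranks(4)]) (auto simp: sum.union_disjoint sum.reindex)
  then show ?thesis using s old by (simp add: flag_count_old_facets)
qed

lemma cells: "{x. x \<in> Q.elements \<and> thickened_rank x = Suc (Suc n)} = t ` {..Suc k}"
proof -
  have "\<rho> x \<noteq> Suc (Suc n)" if "x \<in> Field r" for x using rank_le[OF that] by simp
  then show ?thesis
    using thickened_rank_old thickened_rank_s thickened_rank_t t_fresh t_neq_bottom
    unfolding thickened_ranked(2,3) by auto
qed

lemma flag_count_thickened_cells:
  assumes "V \<subseteq> {..<Suc (Suc n)}"
  shows "flag_count thickened thickened_rank Q.elements (insert (Suc (Suc n)) V) =
    (\<Sum>j \<le> Suc k. flag_count thickened thickened_rank (cell_boundary j - {bottom r}) V)"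
proof -
  have "flag_count thickened thickened_rank Q.elements (insert (Suc (Suc n)) V) =
      (\<Sum>x \<in> t ` {..Suc k}. flag_count thickened thickened_rank (underS thickened x - {bottom r}) V)"
    using underS_Q_subset unfolding cells[symmetric] by (intro flag_count_Q_insert order.refl assms) blast
  also have "\<dots> = (\<Sum>j \<le> Suc k. flag_count thickened thickened_rank (cell_boundary j - {bottom r}) V)"
    using underS_t by (subst sum.reindex[OF t_inj]) (auto intro!: sum.cong simp del: sum.atMost_Suc)
  finally show ?thesis .
qed

lemma sum_cells:
  fixes f :: "nat \<Rightarrow> nat"
  assumes "\<And>j. j \<in> {1..k} \<Longrightarrow> f j = c"
  shows "(\<Sum>j \<le> Suc k. f j) = f 0 + f (Suc k) + k * c"
proof -
  have "(\<Sum>j \<le> Suc k. f j) = f 0 + (\<Sum>j \<in> {1..Suc k}. f j)"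
    by (simp add: sum.atMost_shift sum.atLeast1_atMost_eq)
  also have "(\<Sum>j \<in> {1..Suc k}. f j) = (\<Sum>j \<in> {1..k}. f j) + f (Suc k)" by simp
  also have "(\<Sum>j \<in> {1..k}. f j) = k * c" using assms by simp
  finally show ?thesis by simp
qed

text \<open>In ranks up to n the two outer cells both see all of the old sphere, while each of the k
  lenses sees only the boundary of \<open>s 0\<close>.\<close>

lemma flag_count_thickened_cells_low:
  "flag_count thickened thickened_rank Q.elements (insert (Suc (Suc n)) U) =
     2 * flag_count r \<rho> elements U + k * flag_count r \<rho> facet_boundary U"
proof -
  let ?f = "\<lambda>j. flag_count thickened thickened_rank (cell_boundary j - {bottom r}) U"
  have "?f 0 = flag_count r \<rho> elements U"
    using U_ranks thickened_rank_old by (intro flag_count_old) (auto simp: cell_boundary_def)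
  moreover have "?f (Suc k) = flag_count r \<rho> elements U"
    using U_ranks thickened_rank_old thickened_rank_s[of k] s0
    by (intro flag_count_old) (auto simp: cell_boundary_def)
  moreover have "?f j = flag_count r \<rho> facet_boundary U" if "j \<in> {1..k}" for j
    using that U_ranks thickened_rank_old thickened_rank_s[of j] thickened_rank_s[of "j - 1"]
      underS_subset[of "s 0"]
    by (intro flag_count_old) (auto simp: cell_boundary_def)
  ultimately show ?thesis
    unfolding flag_count_thickened_cells[OF U_ranks(6)] by (subst sum_cells[of ?f "flag_count r \<rho> facet_boundary U"]) simp_all
qed

text \<open>Every element of rank n+1 lies below exactly two cells. Counted by cells, each outer
  cell yields the flags of the old sphere, and each lens yields those of the facet boundary twice,
  once for each of its two layers.\<close>

lemma flag_count_thickened_top: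
  "flag_count thickened thickened_rank Q.elements (insert (Suc (Suc n)) (insert (Suc n) U)) =
     2 * flag_count thickened thickened_rank Q.elements (insert (Suc n) U)"
proof -
  let ?f = "\<lambda>j. flag_count thickened thickened_rank (cell_boundary j - {bottom r}) (insert (Suc n) U)"
  let ?g = "\<lambda>x. flag_count thickened thickened_rank (underS thickened x - {bottom r}) U"
  let ?F = "{x. x \<in> elements \<and> \<rho> x = Suc n}"
  have s: "?g (s j) = flag_count r \<rho> facet_boundary U" if "j \<le> k" for j
    using that flag_count_underS_old[OF s0(1)] by (simp add: underS_s)
  have old: "?g x = flag_count r \<rho> (underS r x - {bottom r}) U" if "x \<in> Field r" for x
    using that flag_count_underS_old by (simp add: underS_old)
  have facets: "(\<Sum>x \<in> ?F. ?g x) = flag_count r \<rho> elements (insert (Suc n) U)"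
    using old by (simp add: flag_count_old_facets)
  have f: "?f j = (\<Sum>x | x \<in> cell_boundary j - {bottom r} \<and> thickened_rank x = Suc n. ?g x)"
    if j: "j \<le> Suc k" for j
  proof (rule flag_count_Q_insert[OF _ _ U_ranks(4)])
    have "t j \<in> Field thickened" unfolding thickened_ranked using j by auto
    then show "cell_boundary j - {bottom r} \<subseteq> Q.elements"
      using underS_Q_subset[of "t j"] underS_t[OF j] by simp
    fix x assume "x \<in> cell_boundary j - {bottom r}"
    then have x: "(x, t j) \<in> thickened" "x \<noteq> t j" using underS_t[OF j] unfolding underS_def by blast+
    have "y \<in> underS thickened (t j)" if "y \<in> underS thickened x" for y
      using that x Q.trans Q.antisym unfolding underS_def by blast
    then show "underS thickened x - {bottom r} \<subseteq> cell_boundary j - {bottom r}"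
      using underS_t[OF j] by blast
  qed
  have "?f 0 = (\<Sum>x \<in> ?F. ?g x)"
    unfolding f[OF le0] using thickened_rank_old by (intro sum.cong) (auto simp: cell_boundary_def)
  \<comment> \<open>Trading \<open>s 0\<close> for \<open>s k\<close> does not change the count,
    because both have the same boundary.\<close>
  moreover have "?f (Suc k) = (\<Sum>x \<in> ?F. ?g x)"
  proof -
    have F: "s 0 \<in> ?F" "finite ?F" using s0 s_neq_bottom[of 0] finite_Field by auto
    have "{x. x \<in> cell_boundary (Suc k) - {bottom r} \<and> thickened_rank x = Suc n} =
        insert (s k) (?F - {s 0})"
      using thickened_rank_old thickened_rank_s[of k] s_neq_bottom[of k] by (auto simp: cell_boundary_def)
    moreover have "s k \<notin> ?F - {s 0}" using s_in_Field_iff[of k] by auto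
    ultimately have "?f (Suc k) = ?g (s k) + (\<Sum>x \<in> ?F - {s 0}. ?g x)"
      unfolding f[OF order.refl] using F by simp
    also have "?g (s k) = ?g (s 0)" using s[of k] s[of 0] by simp
    also have "?g (s 0) + (\<Sum>x \<in> ?F - {s 0}. ?g x) = (\<Sum>x \<in> ?F. ?g x)"
      using F by (metis (no_types, lifting) sum.remove)
    finally show ?thesis .
  qed
  moreover have "?f j = 2 * flag_count r \<rho> facet_boundary U" if j: "j \<in> {1..k}" for j
  proof -
    have j1: "j - 1 \<le> k" "j \<le> k" using j by auto
    have "\<rho> x \<noteq> Suc n" if "x \<in> underS r (s 0)" for x
      using that rank_less[of x "s 0"] s0(2) unfolding underS_def by auto
    then have "{x. x \<in> cell_boundary j - {bottom r} \<and> thickened_rank x = Suc n} = {s (j - 1), s j}"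
      using j thickened_rank_old underS_subset[of "s 0"] thickened_rank_s[OF j1(1)] thickened_rank_s[OF j1(2)]
        s_neq_bottom[OF j1(1)] s_neq_bottom[OF j1(2)]
      by (auto simp: cell_boundary_def)
    moreover have "s (j - 1) \<noteq> s j" using s_eq_iff[OF j1] j by auto
    ultimately have "?f j = ?g (s (j - 1)) + ?g (s j)" using f[of j] j by simp
    then show ?thesis using s[OF j1(1)] s[OF j1(2)] by simp
  qed
  ultimately show ?thesis
    unfolding flag_count_thickened_cells[OF U_ranks(5)] flag_count_thickened_layer facets
    by (subst sum_cells[of ?f "2 * flag_count r \<rho> facet_boundary U"]) simp_all
qed

end

lemma ab_index_thickened:
  "ab_index thickened =
     ab_index r * cd_to_ab LC + of_nat k * ab_index (boundary_poset r (s 0)) * cd_to_ab LD"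
proof -
  interpret Q: ranked_poset thickened thickened_rank "Suc (Suc n)" by (rule thickened_ranked)
  interpret B: ranked_poset "boundary_poset r (s 0)" \<rho> n by (rule boundary_poset_ranked[OF s0])
  have B: "flag_count (boundary_poset r (s 0)) \<rho> B.elements U = flag_count r \<rho> facet_boundary U" for U
    unfolding Field_boundary_poset[OF s0(1)] boundary_poset_ranked(2)[OF s0]
    by (rule flag_count_cong) (auto simp: boundary_poset_def)
  show ?thesis
    unfolding Q.ab_index_eq_flag_count ab_index_eq_flag_count B.ab_index_eq_flag_count B
    by (rule ab_poly_thickening)
      (simp_all add: flag_count_thickened_low flag_count_thickened_layer
        flag_count_thickened_cells_low flag_count_thickened_top)
qed

text \<open>An equality of relations: what is known about the ab-index of \<open>r\<close> becomes
  the statement about the boundary of the next distinguished facet.\<close>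

lemma boundary_thickened: "boundary_poset thickened (t 0) = r"
proof -
  have "(x, y) \<in> r" if "(x, y) \<in> thickened" "y \<in> Field r" for x y
    using that s_fresh t_fresh unfolding thickened_iff layered_iff by blast
  moreover have "underS thickened (t 0) = Field r"
    using underS_t[of 0] by (simp add: cell_boundary_def)
  moreover have "r \<subseteq> thickened" using thickened_iff layered_iff by auto
  ultimately show ?thesis
    using r_Field unfolding boundary_poset_def by auto
qed

end

section \<open>The posets with multiplicative cd-index\<close>

text \<open>The invariant of the induction, indexed by the rank of the boundary of
  \<open>\<sigma>\<close>. It is phrased with the ab-index, which flag counts determine directly,
  and keeps the manifold condition, which does not depend on the field.\<close>

definition multiplicative_pair :: "(nat \<Rightarrow> nat) \<Rightarrow> nat \<Rightarrow> 'a rel \<Rightarrow> 'a \<Rightarrow> bool" where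
  "multiplicative_pair \<alpha> n r \<sigma> \<longleftrightarrow>
     (\<exists>\<rho>. ranked_poset r \<rho> (Suc n) \<and> \<sigma> \<in> Field r \<and> \<rho> \<sigma> = Suc n) \<and>
     manifold_set (comparable r) (Suc n) (Field r - {bottom r}) \<and>
     ab_index r = nc_subst cd_to_ab (multiplicative_cd \<alpha> (Suc n)) \<and>
     ab_index (boundary_poset r \<sigma>) = nc_subst cd_to_ab (multiplicative_cd \<alpha> n)"

lemma point_ranked: "ranked_poset {(a, a)} (\<lambda>_. 0) 0" "bottom {(a, a)} = a"
proof -
  have "is_bottom {(a, a)} a" by (simp add: is_bottom_def Field_def)
  moreover have "Partial_order {(a, a)}"
    by (auto simp: partial_order_on_def preorder_on_def refl_on_def Field_def intro: transI antisymI)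
  ultimately have P: "finite_poset_bot {(a, a)}" by (auto simp: finite_poset_bot_def Field_def)
  show b: "bottom {(a, a)} = a" using P \<open>is_bottom {(a, a)} a\<close> by (rule bottom_eqI)
  show "ranked_poset {(a, a)} (\<lambda>_. 0) 0"
    by unfold_locales (use P in \<open>auto simp: Field_def b\<close>)
qed

lemma ab_index_point: "ab_index {(a, a)} = 1"
proof -
  interpret ranked_poset "{(a, a)}" "\<lambda>_. 0" 0 by (rule point_ranked)
  have "elements = {}" using point_ranked(2)[of a] by (auto simp: Field_def)
  then have "flag_count {(a, a)} (\<lambda>_. 0) elements {} = 1"
    by (simp add: flag_count_def chains_in_empty)
  then show ?thesis
    unfolding ab_index_eq_flag_count ab_poly_def alternating_sum_def
    by (simp add: ab_word_def flip: zero_free_monoid_def)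
qed

lemma multiplicative_pair_0: "\<exists>(r :: nat rel) \<sigma>. multiplicative_pair \<alpha> 0 r \<sigma>"
proof -
  let ?p = "{(0, 0)} :: nat rel"
  interpret P: ranked_poset ?p "\<lambda>_. 0" 0 by (rule point_ranked)
  \<comment> \<open>The sphere of dimension 0: two points over the bottom element 0. Its flag
    numbers 1 and 2 give a + b, which is c.\<close>
  define r where "r = add_maximal ?p {1, 2} id (\<lambda>_. {0})"
  define \<rho> :: "nat \<Rightarrow> nat" where "\<rho> = (\<lambda>x. if x \<in> id ` {1, 2} then Suc 0 else 0)"
  have r: "ranked_poset r \<rho> (Suc 0)" "Field r = Field ?p \<union> id ` {1, 2}" "bottom r = bottom ?p"
    unfolding r_def \<rho>_def
    by (rule P.add_maximal_ranked[of "{1, 2}" id "\<lambda>_. {0}" 0 "Suc 0"]; auto simp: Field_def)+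
  interpret r: ranked_poset r \<rho> "Suc 0" by (rule r)
  have "Field ?p = {0}" by (auto simp: Field_def)
  then have F: "Field r = {0, 1, 2}" "bottom r = 0" using r(2,3) point_ranked(2)[of "0 :: nat"] by auto
  have r_iff: "(x, y) \<in> r \<longleftrightarrow> y \<le> 2 \<and> (x = y \<or> x = 0)" for x y
    unfolding r_def add_maximal_def by auto
  have E: "r.elements = {1, 2}" unfolding F by auto
  have "manifold_set (comparable r) (Suc 0) ({} \<union> {1, 2})"
    by (rule manifold_set_suspension) (auto simp: comparable_def r_iff)
  then have mf: "manifold_set (comparable r) (Suc 0) r.elements" unfolding E by simp
  have c0: "flag_count r \<rho> X {} = 1" for X
  proof -
    have "{C \<in> chains_in r X. \<rho> ` C = {}} = {{}}" by (auto simp: chains_in_def Chains_def)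
    then show ?thesis by (simp add: flag_count_def)
  qed
  have "{x. x \<in> r.elements \<and> \<rho> x = Suc 0} = {1, 2}" unfolding E \<rho>_def by auto
  then have c1: "flag_count r \<rho> r.elements {Suc 0} = 2"
    by (subst r.flag_count_insert) (auto simp: c0)
  have "ab_index r = nc_subst cd_to_ab (multiplicative_cd \<alpha> (Suc 0))"
    unfolding r.ab_index_eq_flag_count ab_poly_Suc
    using nc_subst_mult_var[of cd_to_ab 1 LC]
    by (simp add: c0 c1 ab_poly_def alternating_sum_def ab_word_def nc_subst_one flip: zero_free_monoid_def)
  moreover have "boundary_poset r 1 = ?p"
    unfolding boundary_poset_def underS_def by (auto simp: r_iff)
  then have "ab_index (boundary_poset r 1) = nc_subst cd_to_ab (multiplicative_cd \<alpha> 0)"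
    by (simp add: ab_index_point nc_subst_one)
  ultimately have "multiplicative_pair \<alpha> 0 r 1"
    unfolding multiplicative_pair_def using r(1) mf F by (auto simp: \<rho>_def intro!: exI[of _ \<rho>])
  then show ?thesis by blast
qed

lemma multiplicative_pair_Suc:
  assumes "multiplicative_pair \<alpha> n (r :: nat rel) \<sigma>"
  shows "\<exists>(q :: nat rel) \<tau>. multiplicative_pair \<alpha> (Suc n) q \<tau>"
proof -
  obtain \<rho> where r: "ranked_poset r \<rho> (Suc n)" and \<sigma>: "\<sigma> \<in> Field r" "\<rho> \<sigma> = Suc n"
    and mf: "manifold_set (comparable r) (Suc n) (Field r - {bottom r})"
    and ab: "ab_index r = nc_subst cd_to_ab (multiplicative_cd \<alpha> (Suc n))"
      "ab_index (boundary_poset r \<sigma>) = nc_subst cd_to_ab (multiplicative_cd \<alpha> n)"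
    using assms unfolding multiplicative_pair_def by blast
  interpret r: ranked_poset r \<rho> "Suc n" by (rule r)
  \<comment> \<open>A letter d appended to words of degree n contributes n+1 to
    \<open>kappa\<close>, so the new factor has index n+1.\<close>
  define k where "k = \<alpha> (Suc n)"
  \<comment> \<open>Numbers above \<open>M\<close> are fresh: the layers occupy \<open>M + 1\<close>
    to \<open>M + k\<close>, and the cells start at \<open>M + k + 1\<close>.\<close>
  define M where "M = Max (Field r)"
  have M: "x \<le> M" if "x \<in> Field r" for x using that r.finite_Field unfolding M_def by simp
  define s where "s j = (if j = 0 then \<sigma> else M + j)" for j
  define t where "t j = Suc (M + k + j)" for j
  interpret thick_poset r \<rho> n k s t
  proof
    show "s 0 \<in> Field r" "\<rho> (s 0) = Suc n" using \<sigma> by (simp_all add: s_def)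
    show "s j \<notin> Field r" if "j \<in> {1..k}" for j using that M[of "s j"] by (auto simp: s_def)
    show "t j \<notin> Field r" for j using M[of "t j"] by (auto simp: t_def)
    show "inj_on s {..k}" using M[OF \<sigma>(1)] by (auto simp: inj_on_def s_def split: if_splits)
    show "inj_on t {..Suc k}" by (auto simp: inj_on_def t_def)
    show "s i \<noteq> t j" if "i \<le> k" for i j using that M[OF \<sigma>(1)] by (auto simp: s_def t_def)
  qed
  have s0_eq: "s 0 = \<sigma>" by (simp add: s_def)
  have "t 0 \<in> Field thickened" "thickened_rank (t 0) = Suc (Suc n)"
    unfolding thickened_ranked by (auto simp: thickened_rank_t)
  moreover have "ab_index thickened = nc_subst cd_to_ab (multiplicative_cd \<alpha> (Suc (Suc n)))"
    unfolding ab_index_thickened s0_eq ab unfolding k_def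
    by (simp add: nc_subst_add nc_subst_mult_var nc_subst_of_nat)
  ultimately have "multiplicative_pair \<alpha> (Suc n) thickened (t 0)"
    unfolding multiplicative_pair_def
    using thickened_ranked(1) manifold_thickened[OF mf] ab(1) boundary_thickened by auto
  then show ?thesis by blast
qed

lemma multiplicative_pair_exists: "\<exists>(r :: nat rel) \<sigma>. multiplicative_pair \<alpha> n r \<sigma>"
  by (induction n) (use multiplicative_pair_0 multiplicative_pair_Suc in blast)+

theorem proposition7p10:
  fixes n :: nat and \<alpha> :: "nat \<Rightarrow> nat"
  assumes "n \<ge> 1"
  shows "\<exists>P :: nat rel.
           gorenstein_star TYPE('k::field) P \<and> poset_rank P = n \<and>
           (\<forall>S \<in> sparse_sets n. cd_coeff P S = (\<Prod>i\<in>S. int (\<alpha> i))) \<and>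
           (\<exists>\<sigma> \<in> Field P - {bottom P}. elem_rank P \<sigma> = n \<and>
              (\<forall>S \<in> sparse_sets (n - 1). cd_coeff (boundary_poset P \<sigma>) S = (\<Prod>i\<in>S. int (\<alpha> i))))"
proof -
  obtain m where n: "n = Suc m" using assms by (cases n) auto
  obtain P :: "nat rel" and \<sigma> where "multiplicative_pair \<alpha> m P \<sigma>"
    using multiplicative_pair_exists by blast
  then obtain \<rho> where P: "ranked_poset P \<rho> n" and \<sigma>: "\<sigma> \<in> Field P" "\<rho> \<sigma> = Suc m"
    and mf: "manifold_set (comparable P) n (Field P - {bottom P})"
    and ab: "nc_subst cd_to_ab (multiplicative_cd \<alpha> n) = ab_index P"
      "nc_subst cd_to_ab (multiplicative_cd \<alpha> m) = ab_index (boundary_poset P \<sigma>)"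
    unfolding multiplicative_pair_def n by metis
  interpret ranked_poset P \<rho> n by (rule P)
  interpret B: ranked_poset "boundary_poset P \<sigma>" \<rho> m by (rule boundary_poset_ranked[OF \<sigma>])
  have "\<sigma> \<in> elements" using \<sigma> rank_eq_0_iff[of \<sigma>] by auto
  moreover have "elem_rank P \<sigma> = n" using elem_rank_eq[OF \<open>\<sigma> \<in> elements\<close>] \<sigma>(2) n by simp
  moreover have "gorenstein_star TYPE('k) P" using gorenstein_star_manifold[OF poset mf] .
  moreover have "cd_coeff P S = (\<Prod>i\<in>S. int (\<alpha> i))" if "S \<in> sparse_sets n" for S
    using cd_coeff_multiplicative[OF ab(1) poset_rank_eq that] .
  moreover have "cd_coeff (boundary_poset P \<sigma>) S = (\<Prod>i\<in>S. int (\<alpha> i))" if "S \<in> sparse_sets (n - 1)" for S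
    using cd_coeff_multiplicative[OF ab(2) B.poset_rank_eq] that n by simp
  ultimately show ?thesis using poset_rank_eq by blast
qed

end
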